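(* Let $P=\{P_I\}_{I\in\binom{[n]}{k}}\in\mathbb{R}^{\binom{[n]}{k}}$. Then $P$ is a positive tropical Plücker vector if and only if every face of the regular subdivision $\mathcal D_P$ of $\Delta_{k,n}$ is positroidal.
   Context: $\Delta_{k,n}=\mathrm{conv}\{e_I:I\in\binom{[n]}{k}\}$ with $e_I=\sum_{i\in I}e_i$. $\mathcal D_P$: take the convex hull of the points $(e_I,P_I)\in\mathbb{R}^n\times\mathbb{R}$, take its lower faces (those with an outward normal vector whose last coordinate is negative) and project them to $\Delta_{k,n}$. A subpolytope $\Gamma\subseteq\Delta_{k,n}$ is positroidal if its vertex set, viewed as a subset of $\binom{[n]}{k}$, is the set of bases of a positroid (a matroid whose bases are the $I$ with $p_I(A)\ne0$ for some real $k\times n$ rank-$k$ matrix $A$ with all maximal minors $\ge0$). $P$ is a positive tropical Plücker vector if for every $1\le a<b<c<d\le n$ and every $S\in\binom{[n]}{k-2}$ disjoint from $\{a,b,c,d\}$ (writing $Sab=S\cup\{a,b\}$ etc.), either $P_{Sac}+P_{Sbd}=P_{Sab}+P_{Scd}\le P_{Sad}+P_{Sbc}$ or $P_{Sac}+P_{Sbd}=P_{Sad}+P_{Sbc}\le P_{Sab}+P_{Scd}$. *)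

theory Defs
  imports "HOL-Analysis.Analysis" "HOL-Library.Function_Algebras"
    "Jordan_Normal_Form.DL_Rank" "Jordan_Normal_Form.DL_Submatrix"
begin

text \<open>Pointwise real vector space structure on functions, used to model R^n as
  functions nat => real (only coordinates 0..n-1 are ever nonzero).\<close>

instantiation "fun" :: (type, real_vector) real_vector
begin
definition scaleR_fun :: "real \<Rightarrow> ('a \<Rightarrow> 'b) \<Rightarrow> 'a \<Rightarrow> 'b"
  where "scaleR_fun r f = (\<lambda>x. r *\<^sub>R f x)"
instance
  by standard (simp_all add: scaleR_fun_def fun_eq_iff scaleR_add_right scaleR_add_left)
end

definition ksubsets :: "nat \<Rightarrow> nat \<Rightarrow> nat set set" where
  "ksubsets n k = {I. I \<subseteq> {0..<n} \<and> card I = k}"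

definition eI :: "nat set \<Rightarrow> (nat \<Rightarrow> real)" where
  "eI I = (\<lambda>i. if i \<in> I then 1 else 0)"

definition hypersimplex :: "nat \<Rightarrow> nat \<Rightarrow> (nat \<Rightarrow> real) set" where
  "hypersimplex k n = convex hull (eI ` ksubsets n k)"

definition lifted_polytope :: "nat \<Rightarrow> nat \<Rightarrow> (nat set \<Rightarrow> real) \<Rightarrow> ((nat \<Rightarrow> real) \<times> real) set" where
  "lifted_polytope k n P = convex hull ((\<lambda>I. (eI I, P I)) ` ksubsets n k)"

definition pairing :: "nat \<Rightarrow> (nat \<Rightarrow> real) \<Rightarrow> real \<Rightarrow> (nat \<Rightarrow> real) \<times> real \<Rightarrow> real" where
  "pairing n a b x = (\<Sum>i<n. a i * fst x i) + b * snd x"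

definition lower_face :: "nat \<Rightarrow> ((nat \<Rightarrow> real) \<times> real) set \<Rightarrow> ((nat \<Rightarrow> real) \<times> real) set \<Rightarrow> bool" where
  "lower_face n Q F \<longleftrightarrow> F \<noteq> {} \<and>
     (\<exists>a b. b < 0 \<and> F = {x \<in> Q. \<forall>y \<in> Q. pairing n a b y \<le> pairing n a b x})"

definition subdivision_faces :: "nat \<Rightarrow> nat \<Rightarrow> (nat set \<Rightarrow> real) \<Rightarrow> (nat \<Rightarrow> real) set set" where
  "subdivision_faces k n P = {fst ` F | F. lower_face n (lifted_polytope k n P) F}"

text \<open>Maximal minor p_I(A) of a k x n matrix (columns of I in increasing order).\<close>
definition pluecker :: "nat \<Rightarrow> real mat \<Rightarrow> nat set \<Rightarrow> real" where
  "pluecker k A I = det (submatrix A {0..<k} I)"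

definition is_positroid :: "nat \<Rightarrow> nat \<Rightarrow> nat set set \<Rightarrow> bool" where
  "is_positroid k n B \<longleftrightarrow>
     (\<exists>A :: real mat. A \<in> carrier_mat k n \<and> vec_space.rank k A = k \<and>
        (\<forall>I \<in> ksubsets n k. pluecker k A I \<ge> 0) \<and>
        B = {I \<in> ksubsets n k. pluecker k A I \<noteq> 0})"

definition positroidal :: "nat \<Rightarrow> nat \<Rightarrow> (nat \<Rightarrow> real) set \<Rightarrow> bool" where
  "positroidal k n \<Gamma> \<longleftrightarrow>
     {v. v extreme_point_of \<Gamma>} \<subseteq> eI ` ksubsets n k \<and>
     is_positroid k n {I \<in> ksubsets n k. eI I extreme_point_of \<Gamma>}"

definition positive_tropical_pluecker :: "nat \<Rightarrow> nat \<Rightarrow> (nat set \<Rightarrow> real) \<Rightarrow> bool" where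
  "positive_tropical_pluecker k n P \<longleftrightarrow>
     (\<forall>a b c d S. a < b \<and> b < c \<and> c < d \<and> d < n \<and> S \<subseteq> {0..<n} \<and> card S + 2 = k \<and>
        S \<inter> {a, b, c, d} = {} \<longrightarrow>
        (P (S \<union> {a,c}) + P (S \<union> {b,d}) = P (S \<union> {a,b}) + P (S \<union> {c,d}) \<and>
         P (S \<union> {a,b}) + P (S \<union> {c,d}) \<le> P (S \<union> {a,d}) + P (S \<union> {b,c}))
      \<or> (P (S \<union> {a,c}) + P (S \<union> {b,d}) = P (S \<union> {a,d}) + P (S \<union> {b,c}) \<and>
         P (S \<union> {a,d}) + P (S \<union> {b,c}) \<le> P (S \<union> {a,b}) + P (S \<union> {c,d})))"

end

theory Submission
  imports Defs "Jordan_Normal_Form.DL_Rank_Submatrix"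
begin

text \<open>The faces of \<open>\<D>\<^sub>P\<close> are the polytopes \<open>conv {e\<^sub>I : I \<in> M\<^sub>w}\<close>, where \<open>M\<^sub>w\<close> is the set of
  minimizers of \<open>P I + (\<Sum>i\<in>I. w i)\<close>. If all \<open>M\<^sub>w\<close> are positroids, choose \<open>w\<close> so that \<open>M\<^sub>w\<close> lies in an
  octahedron \<open>{Sab, \<dots>, Scd}\<close> and opposite vertices have equal values; the three-term Pluecker
  relation \<open>p\<^bsub>Sac\<^esub> p\<^bsub>Sbd\<^esub> = p\<^bsub>Sab\<^esub> p\<^bsub>Scd\<^esub> + p\<^bsub>Sad\<^esub> p\<^bsub>Sbc\<^esub>\<close> with nonnegative terms then forces the tropical one.

  Conversely, adding \<open>w\<close> or a constant preserves positive tropical Pluecker vectors, so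
  \<open>w = 0\<close> and \<open>P {0..<k} = 0\<close> may be assumed.
  There is a curve of matrices whose minors on the sets \<open>{0..<i} \<union> {s..<e}\<close> are exactly
  \<open>exp (- (P I * x))\<close>. All other minors arise from these by three-term relations without
  subtraction, so each minor \<open>I\<close> is asymptotic to a positive multiple of \<open>exp (- (P I * x))\<close> as
  \<open>x \<rightarrow> \<infinity>\<close>. Normalizing a minor of minimal \<open>P\<close> to \<open>1\<close> and letting \<open>x \<rightarrow> \<infinity>\<close> gives a matrix with
  nonnegative minors that are nonzero exactly on the minimizers of \<open>P\<close>.\<close>

section \<open>Determinants of column lists and the three-term relation\<close>

text \<open>A column is a function on all of \<open>nat\<close>, of which only the first
  \<open>length vs\<close> entries count. Lists of any length can then be handled without dimension
  bookkeeping.\<close>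

definition coldet :: "(nat \<Rightarrow> real) list \<Rightarrow> real" where
  "coldet vs = det (mat (length vs) (length vs) (\<lambda>(i, j). (vs ! j) i))"

lemma coldet_swap: "coldet (us @ x # y # ws) = - coldet (us @ y # x # ws)"
proof -
  let ?vs = "us @ y # x # ws" and ?m = "length us"
  let ?n = "length ?vs"
  let ?B = "mat ?n ?n (\<lambda>(i, j). (?vs ! j) i)"
  have "mat ?n ?n (\<lambda>(i, j). ((us @ x # y # ws) ! j) i) = swapcols ?m (Suc ?m) ?B"
    by (rule eq_matI) (auto simp: mat_swapcols_def nth_append nth_Cons split: nat.splits)
  moreover have "det (swapcols ?m (Suc ?m) ?B) = - det ?B"
    by (rule det_swapcols[of _ ?n]) auto
  ultimately show ?thesis
    by (simp add: coldet_def)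
qed

lemma coldet_move:
  "coldet (us @ x # ws @ zs) = (- 1) ^ length ws * coldet (us @ ws @ x # zs)"
proof (induction ws arbitrary: us)
  case (Cons w ws)
  have "coldet (us @ x # (w # ws) @ zs) = - coldet ((us @ [w]) @ x # ws @ zs)"
    using coldet_swap[of us x w "ws @ zs"] by simp
  then show ?case
    using Cons.IH[of "us @ [w]"] by simp
qed simp

lemma coldet_not_distinct:
  assumes "\<not> distinct vs"
  shows "coldet vs = 0"
proof -
  obtain i j where "i < length vs" "j < length vs" "i \<noteq> j" "vs ! i = vs ! j"
    using assms by (auto simp: distinct_conv_nth)
  then show ?thesis
    unfolding coldet_def by (intro det_identical_columns[of _ "length vs" i j]) auto
qed

text \<open>The cofactors along the last column do not involve that column, so one coefficient
  family \<open>K\<close> serves every \<open>x\<close>.\<close>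

lemma coldet_linear_last:
  obtains K where "\<And>x. coldet (us @ [x]) = (\<Sum>r<Suc (length us). K r * x r)"
proof -
  let ?m = "length us"
  let ?M = "\<lambda>x. mat (Suc ?m) (Suc ?m) (\<lambda>(i, j). ((us @ [x]) ! j) i)"
  have "coldet (us @ [x]) = (\<Sum>r<Suc ?m. cofactor (?M (\<lambda>_. 0)) r ?m * x r)" for x
  proof -
    have "mat_delete (?M x) r ?m = mat_delete (?M (\<lambda>_. 0)) r ?m" if "r < Suc ?m" for r
      using that by (intro eq_matI) (auto simp: mat_delete_def nth_append)
    then have "cofactor (?M x) r ?m = cofactor (?M (\<lambda>_. 0)) r ?m" if "r < Suc ?m" for r
      using that by (simp add: cofactor_def)
    moreover have "coldet (us @ [x]) = (\<Sum>r<Suc ?m. ?M x $$ (r, ?m) * cofactor (?M x) r ?m)"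
      unfolding coldet_def using laplace_expansion_column[of "?M x" "Suc ?m" ?m] by simp
    ultimately show ?thesis
      by (auto intro!: sum.cong simp: mult.commute)
  qed
  then show thesis by (rule that)
qed

text \<open>Evaluating the linear form at the unit vectors identifies its coefficients.\<close>

lemma coldet_expand_last:
  "coldet (us @ [x]) = (\<Sum>r<Suc (length us). coldet (us @ [\<lambda>i. if i = r then 1 else 0]) * x r)"
proof -
  obtain K where K: "\<And>x. coldet (us @ [x]) = (\<Sum>r<Suc (length us). K r * x r)"
    using coldet_linear_last by blast
  have "coldet (us @ [\<lambda>i. if i = r then 1 else 0]) = K r" if "r < Suc (length us)" for r
    using that by (simp add: K if_distrib[of "\<lambda>z. _ * z"] cong: if_cong)
  then show ?thesis by (simp add: K)
qed

text \<open>The matrix below has linearly dependent rows; its expansion along the last row is the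
  relation.\<close>

lemma coldet_three_term:
  "coldet (us @ [a, c]) * coldet (us @ [b, d]) =
   coldet (us @ [a, b]) * coldet (us @ [c, d]) + coldet (us @ [a, d]) * coldet (us @ [b, c])"
proof -
  let ?m = "length us"
  define n where "n = ?m + 3"
  define vs where "vs = us @ [a, b, c]"
  define f where "f x y = coldet (us @ [x, y])" for x y
  have len: "length vs = n" by (simp add: vs_def n_def)
  define M where "M = mat n n (\<lambda>(i, j). if i = n - 1 then f (vs ! j) d else (vs ! j) i)"
  have M: "M \<in> carrier_mat n n" by (simp add: M_def)
  \<comment> \<open>By linearity the last row of \<open>M\<close> is a combination of the other
    rows. Moving \<open>d\<close> behind \<open>x\<close> produces the minus sign in
    \<open>fK\<close>.\<close>
  obtain K where K: "\<And>x. coldet ((us @ [d]) @ [x]) = (\<Sum>r<Suc (length (us @ [d])). K r * x r)"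
    using coldet_linear_last by blast
  have fK: "f x d = - (\<Sum>r<n - 1. K r * x r)" for x
    using coldet_swap[of us x d "[]"] K[of x] by (simp add: f_def n_def numeral_3_eq_3)
  \<comment> \<open>\<open>w\<close> records this dependency of the rows; its last entry
    \<open>1\<close> makes it nonzero.\<close>
  define w where "w = vec n (\<lambda>i. if i = n - 1 then 1 else K i)"
  have w: "w \<in> carrier_vec n" by (simp add: w_def)
  have "w $ (n - 1) = 1" by (simp add: w_def n_def)
  then have w0: "w \<noteq> 0\<^sub>v n" using n_def by auto
  have "M\<^sup>T *\<^sub>v w = 0\<^sub>v n"
  proof (rule eq_vecI)
    fix j assume "j < dim_vec (0\<^sub>v n :: real vec)"
    then have j: "j < n" by simp
    have n1: "n = Suc (n - 1)" by (simp add: n_def)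
    have "(M\<^sup>T *\<^sub>v w) $ j = (\<Sum>i\<in>{0..<n}. M $$ (i, j) * w $ i)"
      using j M w by (simp add: scalar_prod_def)
    also have "\<dots> = (\<Sum>i\<in>{0..<n - 1}. M $$ (i, j) * w $ i) + M $$ (n - 1, j) * w $ (n - 1)"
      by (subst n1) simp
    also have "\<dots> = (\<Sum>i\<in>{0..<n - 1}. K i * (vs ! j) i) + f (vs ! j) d"
      using j by (auto simp: M_def w_def intro!: sum.cong)
    also have "\<dots> = 0"
      by (simp add: fK lessThan_atLeast0)
    finally show "(M\<^sup>T *\<^sub>v w) $ j = 0\<^sub>v n $ j" using j by simp
  qed (simp add: M_def)
  then have "det M = 0"
    using det_0_iff_vec_prod_zero[of "M\<^sup>T" n] M w w0 det_transpose[OF M] by auto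
  moreover have "det M = (\<Sum>j<n. f (vs ! j) d * cofactor M (n - 1) j)"
  proof -
    have "det M = (\<Sum>j<n. M $$ (n - 1, j) * cofactor M (n - 1) j)"
      using laplace_expansion_row[OF M, of "n - 1"] by (simp add: n_def)
    also have "\<dots> = (\<Sum>j<n. f (vs ! j) d * cofactor M (n - 1) j)"
      by (intro sum.cong) (auto simp: M_def)
    finally show ?thesis .
  qed
  \<comment> \<open>A column of \<open>us\<close> would occur twice in \<open>f\<close>, so only the
    entries of the last row at \<open>a\<close>, \<open>b\<close>, \<open>c\<close> survive the
    expansion.\<close>
  moreover have "f (vs ! j) d = 0" if "j < ?m" for j
    unfolding f_def using that by (intro coldet_not_distinct) (auto simp: vs_def nth_append)
  moreover have "cofactor M (n - 1) j = (- 1) ^ (n - 1 + j) * coldet (take j vs @ drop (Suc j) vs)"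
    if "j < n" for j
  proof -
    have "mat_delete M (n - 1) j =
      mat (n - 1) (n - 1) (\<lambda>(i, l). ((take j vs @ drop (Suc j) vs) ! l) i)"
      using that len by (intro eq_matI) (auto simp: mat_delete_def M_def nth_append)
    moreover have "length (take j vs @ drop (Suc j) vs) = n - 1"
      using that len by auto
    ultimately show ?thesis by (simp add: cofactor_def coldet_def)
  qed
  ultimately have "0 = f a d * ((- 1) ^ (n - 1 + ?m) * f b c) +
     f b d * ((- 1) ^ (n - 1 + (?m + 1)) * f a c) + f c d * ((- 1) ^ (n - 1 + (?m + 2)) * f a b)"
    by (simp add: n_def vs_def f_def numeral_3_eq_3 nth_append)
  then show ?thesis
    by (simp add: f_def n_def mult.commute algebra_simps)
qed

section \<open>Minors indexed by column sets, and their signs\<close>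

definition minor :: "(nat \<Rightarrow> nat \<Rightarrow> real) \<Rightarrow> nat set \<Rightarrow> real" where
  "minor v I = coldet (map v (sorted_list_of_set I))"

text \<open>\<open>submatrix\<close> enumerates columns with \<open>pick\<close>. This translates
  Pluecker coordinates into the list form in which columns can be moved and replaced.\<close>

lemma pluecker_eq_minor:
  assumes A: "A \<in> carrier_mat k n" and I: "I \<in> ksubsets n k"
  shows "pluecker k A I = minor (\<lambda>j i. A $$ (i, j)) I"
proof -
  let ?xs = "sorted_list_of_set I"
  have fin: "finite I" and sub: "I \<subseteq> {0..<n}" and card: "card I = k"
    using I by (auto simp: ksubsets_def intro: finite_subset)
  \<comment> \<open>The entry at position \<open>j\<close> has exactly \<open>j\<close> smaller
    elements in \<open>I\<close>, which is what identifies \<open>pick I j\<close>.\<close>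
  have pickI: "pick I j = ?xs ! j" if j: "j < k" for j
  proof -
    have "{x \<in> I. x < ?xs ! j} = (\<lambda>i. ?xs ! i) ` {0..<j}"
    proof -
      have *: "sorted_wrt (<) ?xs" by (rule strict_sorted_list_of_set)
      have lt: "?xs ! i < ?xs ! l" if "i < l" "l < k" for i l
        using that * card unfolding sorted_wrt_iff_nth_less by auto
      show ?thesis
      proof (intro equalityI subsetI)
        fix x assume x: "x \<in> {x \<in> I. x < ?xs ! j}"
        then obtain i where i: "i < k" "x = ?xs ! i"
          using fin card by (metis (no_types, lifting) in_set_conv_nth length_sorted_list_of_set
            mem_Collect_eq set_sorted_list_of_set)
        have "\<not> j < i" "i \<noteq> j" using lt[of j i] i x by auto
        then have "i < j" by simp
        then show "x \<in> (\<lambda>i. ?xs ! i) ` {0..<j}" using i by auto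
      next
        fix x assume "x \<in> (\<lambda>i. ?xs ! i) ` {0..<j}"
        then obtain i where i: "i < j" "x = ?xs ! i" by auto
        have "x \<in> I"
          using i j fin card by (metis length_sorted_list_of_set less_trans nth_mem
            set_sorted_list_of_set)
        then show "x \<in> {x \<in> I. x < ?xs ! j}" using lt[of i j] i j by simp
      qed
    qed
    moreover have "inj_on (\<lambda>i. ?xs ! i) {0..<j}"
      using j card by (intro inj_on_nth) auto
    ultimately have "card {x \<in> I. x < ?xs ! j} = j" by (simp add: card_image)
    moreover have "?xs ! j \<in> I"
      using j fin card by (metis length_sorted_list_of_set nth_mem set_sorted_list_of_set)
    ultimately show ?thesis using pick_card_in_set[of "?xs ! j" I] by simp
  qed
  have pickk: "pick {0..<k} i = i" if "i < k" for i
  proof -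
    have "{a \<in> {0..<k}. a < i} = {0..<i}" using that by auto
    then show ?thesis using pick_card_in_set[of i "{0..<k}"] that by simp
  qed
  have c1: "card {i. i < k \<and> i \<in> {0..<k}} = k" by simp
  have "{j. j < n \<and> j \<in> I} = I" using sub by auto
  then have c2: "card {j. j < n \<and> j \<in> I} = k" using card by simp
  have "submatrix A {0..<k} I = mat k k (\<lambda>(i, j). A $$ (i, ?xs ! j))"
    unfolding submatrix_def using A c1 c2 by (intro eq_matI) (auto simp: pickI pickk)
  moreover have "mat k k (\<lambda>(i, j). A $$ (i, ?xs ! j)) =
      mat k k (\<lambda>(i, j). (map (\<lambda>j i. A $$ (i, j)) ?xs ! j) i)"
    using card fin by (intro eq_matI) auto
  ultimately show ?thesis
    using card fin by (simp add: pluecker_def minor_def coldet_def)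
qed

text \<open>On its way from its sorted place to the end of the block, the column \<open>v x\<close>
  passes exactly the columns with a larger index.\<close>

lemma coldet_insort:
  assumes "sorted xs" "x \<notin> set xs" "distinct xs"
  shows "coldet (us @ map v (insort x xs) @ ws) =
    (- 1) ^ card {y \<in> set xs. x < y} * coldet (us @ map v xs @ v x # ws)"
  using assms
proof (induction xs arbitrary: us)
  case (Cons y xs)
  show ?case
  proof (cases "x \<le> y")
    case True
    then have "{z \<in> set (y # xs). x < z} = set (y # xs)"
      using Cons.prems by fastforce
    then have "card {z \<in> set (y # xs). x < z} = length (map v (y # xs))"
      using Cons.prems by (simp only: distinct_card length_map)
    moreover have "insort x (y # xs) = x # (y # xs)" using True by simp
    ultimately show ?thesis
      using coldet_move[of us "v x" "map v (y # xs)" ws] by simp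
  next
    case False
    then have "{z \<in> set (y # xs). x < z} = {z \<in> set xs. x < z}" by auto
    moreover have "insort x (y # xs) = y # insort x xs" using False by simp
    ultimately show ?thesis
      using Cons.IH[of "us @ [v y]"] Cons.prems by simp
  qed
qed simp

text \<open>The sign splits into one factor for \<open>x\<close> and one for \<open>y\<close>: the
  extra sign from \<open>x\<close> passing \<open>y\<close> cancels against the swap of the last two
  columns.\<close>

lemma minor_insert_two:
  assumes "finite S" "x < y" "x \<notin> S" "y \<notin> S"
  shows "minor v (S \<union> {x, y}) =
    (- 1) ^ (card {z \<in> S. x < z} + card {z \<in> S. y < z}) *
    coldet (map v (sorted_list_of_set S) @ [v x, v y])"
proof -
  define L where "L = sorted_list_of_set S"
  define L' where "L' = sorted_list_of_set (insert y S)"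
  have L: "set L = S" "sorted L" "distinct L" and L': "set L' = insert y S" "sorted L'" "distinct L'"
    unfolding L_def L'_def using assms
    by (simp_all only: set_sorted_list_of_set finite_insert sorted_sorted_list_of_set
        distinct_sorted_list_of_set)
  have sy: "L' = insort y L"
    unfolding L_def L'_def using assms by (simp add: sorted_list_of_set_insert)
  have "S \<union> {x, y} = insert x (insert y S)" by auto
  then have sx: "sorted_list_of_set (S \<union> {x, y}) = insort x L'"
    unfolding L'_def using assms by (simp add: sorted_list_of_set_insert)
  have "{z \<in> insert y S. x < z} = insert y {z \<in> S. x < z}" using assms by auto
  then have c: "card {z \<in> insert y S. x < z} = Suc (card {z \<in> S. x < z})"
    using assms by simp
  have "coldet ([] @ map v (insort x L') @ []) = (- 1) ^ card {z \<in> set L'. x < z} *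
      coldet ([] @ map v L' @ v x # [])"
    by (rule coldet_insort) (use L' assms in auto)
  then have "minor v (S \<union> {x, y}) = (- 1) ^ card {z \<in> insert y S. x < z} *
      coldet (map v L' @ [v x])"
    by (simp only: minor_def sx L' append_Nil append_Nil2)
  also have "coldet (map v L' @ [v x]) =
      (- 1) ^ card {z \<in> S. y < z} * coldet (map v L @ [v y, v x])"
    unfolding sy using coldet_insort[of L y "[]" v "[v x]"] assms L by simp
  also have "coldet (map v L @ [v y, v x]) = - coldet (map v L @ [v x, v y])"
    using coldet_swap[of "map v L" "v y" "v x" "[]"] by simp
  finally show ?thesis unfolding c by (simp add: power_add L_def)
qed

text \<open>Each of the three products uses \<open>a\<close>, \<open>b\<close>, \<open>c\<close>,
  \<open>d\<close> once, so the signs of \<open>minor_insert_two\<close> form a common factor of the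
  relation for \<open>coldet\<close>.\<close>

theorem minor_three_term:
  assumes "finite S" "a < b" "b < c" "c < d" "S \<inter> {a, b, c, d} = {}"
  shows "minor v (S \<union> {a, c}) * minor v (S \<union> {b, d}) =
    minor v (S \<union> {a, b}) * minor v (S \<union> {c, d}) +
    minor v (S \<union> {a, d}) * minor v (S \<union> {b, c})"
proof -
  let ?e = "\<lambda>x. (- 1 :: real) ^ card {z \<in> S. x < z}"
  let ?D = "\<lambda>x y. coldet (map v (sorted_list_of_set S) @ [v x, v y])"
  have m: "minor v (S \<union> {x, y}) = ?e x * ?e y * ?D x y"
    if "x \<in> {a, b, c, d}" "y \<in> {a, b, c, d}" "x < y" for x y
    using minor_insert_two[of S x y v] that assms by (auto simp: power_add)
  have "?D a c * ?D b d = ?D a b * ?D c d + ?D a d * ?D b c"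
    by (rule coldet_three_term)
  then have "(?e a * ?e b * ?e c * ?e d) * (?D a c * ?D b d) =
    (?e a * ?e b * ?e c * ?e d) * (?D a b * ?D c d + ?D a d * ?D b c)" by simp
  moreover have "minor v (S \<union> {a, c}) = ?e a * ?e c * ?D a c" "minor v (S \<union> {b, d}) = ?e b * ?e d * ?D b d"
    "minor v (S \<union> {a, b}) = ?e a * ?e b * ?D a b" "minor v (S \<union> {c, d}) = ?e c * ?e d * ?D c d"
    "minor v (S \<union> {a, d}) = ?e a * ?e d * ?D a d" "minor v (S \<union> {b, c}) = ?e b * ?e c * ?D b c"
    using assms by (intro m; simp)+
  ultimately show ?thesis
    by (simp only: distrib_left mult_ac)
qed

section \<open>Sorting, change of basis and limits of column determinants\<close>

text \<open>The factor \<open>s\<close> is chosen before \<open>v\<close>: later the list stays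
  fixed while \<open>v\<close> runs through a family of matrices.\<close>

lemma coldet_sort:
  assumes "distinct xs"
  shows "\<exists>s. s \<noteq> 0 \<and> (\<forall>v. coldet (map v (us @ xs)) = s * coldet (map v (us @ sort xs)))"
  using assms
proof (induction xs arbitrary: us)
  case Nil
  show ?case by (rule exI[of _ 1]) simp
next
  case (Cons x xs)
  obtain s where s: "s \<noteq> 0"
    "\<And>v. coldet (map v ((us @ [x]) @ xs)) = s * coldet (map v ((us @ [x]) @ sort xs))"
    using Cons.IH[of "us @ [x]"] Cons.prems by auto
  let ?t = "(- 1 :: real) ^ length xs * (- 1) ^ card {y \<in> set xs. x < y}"
  have "coldet (map v (us @ x # xs)) = s * ?t * coldet (map v (us @ sort (x # xs)))" for v
  proof -
    have "coldet (map v us @ map v (insort x (sort xs)) @ []) =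
      (- 1) ^ card {y \<in> set xs. x < y} * coldet (map v us @ map v (sort xs) @ v x # [])"
      using coldet_insort[of "sort xs" x "map v us" v "[]"] Cons.prems by simp
    then have "coldet (map v us @ map v (sort xs) @ [v x]) =
      (- 1) ^ card {y \<in> set xs. x < y} * coldet (map v (us @ sort (x # xs)))"
      by (simp flip: power_mult_distrib mult.assoc power_add)
    then show ?thesis
      using s(2)[of v] coldet_move[of "map v us" "v x" "map v (sort xs)" "[]"] by simp
  qed
  then show ?case using s(1) by (intro exI[of _ "s * ?t"]) simp
qed

corollary coldet_eq_minor:
  assumes "distinct xs"
  obtains s where "\<And>v. coldet (map v xs) = s * minor v (set xs)"
  using coldet_sort[OF assms, of "[]"] assms
  by (auto simp: minor_def sorted_list_of_set_sort_remdups distinct_remdups_id)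

text \<open>Cramer's rule: the coordinates of \<open>y\<close> in the basis \<open>us\<close> are
  quotients of determinants.\<close>

lemma coldet_cramer:
  assumes "coldet us \<noteq> 0" "i < length us"
  shows "y i = (\<Sum>r<length us. (us ! r) i * (coldet (us[r := y]) / coldet us))"
proof -
  define n where "n = length us"
  define U where "U = mat n n (\<lambda>(i, j). (us ! j) i)"
  define b where "b = vec n y"
  have U: "U \<in> carrier_mat n n" and b: "b \<in> carrier_vec n" by (auto simp: U_def b_def)
  have detU: "det U = coldet us" by (simp add: U_def n_def coldet_def)
  define z where "z = (1 / det U) \<cdot>\<^sub>v (adj_mat U *\<^sub>v b)"
  note adj = adj_mat[OF U]
  have z: "z \<in> carrier_vec n" using adj b by (simp add: z_def)
  have "U *\<^sub>v z = (1 / det U) \<cdot>\<^sub>v (U *\<^sub>v (adj_mat U *\<^sub>v b))"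
    unfolding z_def using U adj b by (intro mult_mat_vec[of _ n n]) auto
  also have "U *\<^sub>v (adj_mat U *\<^sub>v b) = (U * adj_mat U) *\<^sub>v b"
    using U adj b by (intro assoc_mult_mat_vec[symmetric]) auto
  also have "\<dots> = det U \<cdot>\<^sub>v b" using adj b by auto
  finally have Uz: "U *\<^sub>v z = b" using detU assms(1) by (simp add: smult_smult_assoc)
  have zr: "z $ r = coldet (us[r := y]) / coldet us" if r: "r < n" for r
  proof -
    have "replace_col U b r = mat n n (\<lambda>(i, j). (us[r := y] ! j) i)"
      using r by (intro eq_matI) (auto simp: replace_col_def U_def b_def n_def nth_list_update)
    then have "coldet (us[r := y]) = z $ r * coldet us"
      using cramer_lemma_mat[OF U z r] Uz detU by (simp add: coldet_def n_def)
    then show ?thesis using assms(1) by simp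
  qed
  have "y i = (U *\<^sub>v z) $ i" using Uz assms(2) by (simp add: b_def n_def)
  also have "\<dots> = (\<Sum>r<n. U $$ (i, r) * z $ r)"
    using assms(2) U z by (simp add: scalar_prod_def n_def lessThan_atLeast0)
  also have "\<dots> = (\<Sum>r<n. (us ! r) i * (coldet (us[r := y]) / coldet us))"
    using assms(2) by (intro sum.cong) (auto simp: zr U_def n_def)
  finally show ?thesis by (simp add: n_def)
qed

text \<open>Expressing the columns \<open>ys\<close> in the basis \<open>us\<close> factors their
  matrix, and the determinant is multiplicative. This is what normalizes a chosen nonzero minor to
  \<open>1\<close>.\<close>

lemma coldet_change_basis:
  assumes "coldet us \<noteq> 0" "length ys = length us"
  shows "coldet ys = coldet us * coldet (map (\<lambda>y r. coldet (us[r := y]) / coldet us) ys)"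
proof -
  define n where "n = length us"
  define U where "U = mat n n (\<lambda>(i, j). (us ! j) i)"
  define Z where "Z = mat n n (\<lambda>(r, j). coldet (us[r := ys ! j]) / coldet us)"
  have "mat n n (\<lambda>(i, j). (ys ! j) i) = U * Z"
  proof (rule eq_matI)
    fix i j assume "i < dim_row (U * Z)" "j < dim_col (U * Z)"
    then have ij: "i < n" "j < n" by (auto simp: U_def Z_def)
    have "(ys ! j) i = (\<Sum>r<n. (us ! r) i * (coldet (us[r := ys ! j]) / coldet us))"
      using coldet_cramer[OF assms(1)] ij by (simp add: n_def)
    then show "mat n n (\<lambda>(i, j). (ys ! j) i) $$ (i, j) = (U * Z) $$ (i, j)"
      using ij by (simp add: U_def Z_def scalar_prod_def lessThan_atLeast0)
  qed (auto simp: U_def Z_def)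
  moreover have "det (U * Z) = det U * det Z"
    by (rule det_mult[of _ n]) (auto simp: U_def Z_def)
  moreover have "Z = mat n n (\<lambda>(i, j). (map (\<lambda>y r. coldet (us[r := y]) / coldet us) ys ! j) i)"
    using assms(2) by (intro eq_matI) (auto simp: Z_def n_def)
  ultimately show ?thesis
    using assms(2) by (simp add: coldet_def U_def n_def)
qed

text \<open>The Leibniz formula is a polynomial in the entries.\<close>

lemma tendsto_coldet:
  assumes "\<And>i j. i < length xs \<Longrightarrow> j < length xs \<Longrightarrow>
    ((\<lambda>t. v t (xs ! j) i) \<longlongrightarrow> w (xs ! j) i) F"
  shows "((\<lambda>t. coldet (map (v t) xs)) \<longlongrightarrow> coldet (map w xs)) F"
proof -
  let ?n = "length xs"
  have lt: "p i < ?n" if "p permutes {0..<?n}" "i < ?n" for p i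
    using permutes_in_image[OF that(1), of i] that(2) by auto
  have eq: "coldet (map u xs) =
      (\<Sum>p | p permutes {0..<?n}. signof p * (\<Prod>i = 0..<?n. u (xs ! p i) i))" for u
    unfolding coldet_def
    by (subst det_def') (auto intro!: sum.cong prod.cong simp: lt)
  show ?thesis
    unfolding eq using assms
    by (intro tendsto_sum tendsto_mult tendsto_prod tendsto_const) (auto simp: lt)
qed

lemma coldet_unit_columns:
  "coldet (map (\<lambda>j i. if i = j then 1 else 0) [0..<k]) = 1"
proof -
  have "mat k k (\<lambda>(i, j). (map (\<lambda>j i. if i = j then 1 else 0) [0..<k] ! j) i) = (1\<^sub>m k :: real mat)"
    by (rule eq_matI) auto
  then show ?thesis by (simp add: coldet_def)
qed

section \<open>Matrices with prescribed minors\<close>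

text \<open>Back substitution from the last equation upwards; \<open>m\<close> counts the equations
  solved so far.\<close>

lemma triangular_system:
  fixes g :: "nat \<Rightarrow> nat \<Rightarrow> real"
  assumes "\<And>i. i < k \<Longrightarrow> g i i \<noteq> 0" "\<And>i r. r < i \<Longrightarrow> i < k \<Longrightarrow> g i r = 0"
  shows "\<exists>x. \<forall>i<k. (\<Sum>r<k. g i r * x r) = q i"
proof -
  have "\<exists>x. \<forall>i. k - m \<le> i \<and> i < k \<longrightarrow> (\<Sum>r<k. g i r * x r) = q i" if "m \<le> k" for m
    using that
  proof (induction m)
    case (Suc m)
    then obtain x where x: "\<And>i. k - m \<le> i \<Longrightarrow> i < k \<Longrightarrow> (\<Sum>r<k. g i r * x r) = q i"
      by auto
    define l where "l = k - Suc m"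
    have l: "l < k" "k - m = Suc l" using Suc.prems by (auto simp: l_def)
    \<comment> \<open>Only the unknown \<open>l\<close> changes, so as to satisfy equation
      \<open>l\<close>; in the later equations its coefficient is \<open>0\<close>.\<close>
    define z where "z = (q l - (\<Sum>r\<in>{..<k} - {l}. g l r * x r)) / g l l"
    have split: "(\<Sum>r<k. g i r * (x(l := z)) r) = g i l * z + (\<Sum>r\<in>{..<k} - {l}. g i r * x r)"
      "(\<Sum>r<k. g i r * x r) = g i l * x l + (\<Sum>r\<in>{..<k} - {l}. g i r * x r)" for i
      using l by (subst sum.remove[of _ l]; simp)+
    have "(\<Sum>r<k. g i r * (x(l := z)) r) = q i" if "l \<le> i" "i < k" for i
    proof (cases "i = l")
      case True
      then show ?thesis using split(1)[of l] assms(1)[of l] l by (simp add: z_def)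
    next
      case False
      then show ?thesis
        using split[of i] x[of i] assms(2)[of l i] that l by simp
    qed
    then show ?case unfolding l_def[symmetric] by blast
  qed auto
  from this[of k] show ?thesis by auto
qed

text \<open>Column \<open>c\<close> has \<open>k\<close> entries and is the last column of \<open>k\<close> of the prescribed minors, whose
  equations form a triangular system with the minors of the previous columns on the diagonal.\<close>

lemma prescribed_minors:
  fixes q :: "nat \<Rightarrow> nat \<Rightarrow> real"
  assumes q: "\<And>i c. q i c \<noteq> 0"
  shows "\<exists>v. (\<forall>j<k. v j = (\<lambda>i. if i = j then 1 else 0)) \<and>
    (\<forall>i c. i < k \<and> k \<le> c \<and> c < n \<longrightarrow>
      coldet (map v ([0..<i] @ [c + 1 + i - k..<c + 1])) = q i c)"
proof (induction n)
  case 0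
  show ?case by (intro exI[of _ "\<lambda>j i. if i = j then 1 else 0"]) simp
next
  case (Suc n)
  then obtain v where unit: "\<And>j. j < k \<Longrightarrow> v j = (\<lambda>i. if i = j then 1 else 0)"
    and v: "\<And>i c. i < k \<Longrightarrow> k \<le> c \<Longrightarrow> c < n \<Longrightarrow>
      coldet (map v ([0..<i] @ [c + 1 + i - k..<c + 1])) = q i c"
    by blast
  show ?case
  proof (cases "k \<le> n")
    case False
    then show ?thesis using unit v by (intro exI[of _ v]) auto
  next
    case True
    \<comment> \<open>These are the \<open>k - 1\<close> columns that accompany the new column
      \<open>n\<close> in its prescribed minor with index \<open>i\<close>.\<close>
    define us where "us i = map v ([0..<i] @ [n + 1 + i - k..<n])" for i
    have len: "Suc (length (us i)) = k" if "i < k" for i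
      using that True by (auto simp: us_def)
    define g where "g i r = coldet (us i @ [v r])" for i r
    \<comment> \<open>For \<open>r < i\<close> the column \<open>v r\<close> already occurs in
      \<open>us i\<close>.\<close>
    have g0: "g i r = 0" if "r < i" "i < k" for i r
      unfolding g_def using that by (intro coldet_not_distinct) (auto simp: us_def)
    have idcols: "coldet (map v [0..<k]) = 1"
    proof -
      have "map v [0..<k] = map (\<lambda>j i. if i = j then 1 else 0) [0..<k]" using unit by simp
      then show ?thesis by (simp only: coldet_unit_columns)
    qed
    \<comment> \<open>Moving \<open>v i\<close> into place turns \<open>g i i\<close>, up to sign,
      into the prescribed minor with index \<open>Suc i\<close> and last column
      \<open>n - 1\<close>, or into the unit block when \<open>Suc i = k\<close> or
      \<open>n = k\<close>.\<close>
    have gi: "g i i \<noteq> 0" if i: "i < k" for i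
    proof -
      have "coldet (map v ([0..<Suc i] @ [n + 1 + i - k..<n])) \<noteq> 0"
      proof (cases "Suc i = k \<or> n = k")
        case True
        then have "[0..<Suc i] @ [n + 1 + i - k..<n] = [0..<k]"
          using i upt_add_eq_append[of 0 "Suc i" "k - Suc i"] by auto
        then show ?thesis using idcols by (simp only:)
      next
        case False
        then have "k \<le> n - 1" using \<open>k \<le> n\<close> by auto
        then show ?thesis
          using False v[of "Suc i" "n - 1"] q[of "Suc i" "n - 1"] i \<open>k \<le> n\<close> by simp
      qed
      moreover have "coldet (map v [0..<i] @ v i # map v [n + 1 + i - k..<n] @ []) =
          (- 1) ^ length (map v [n + 1 + i - k..<n]) * g i i"
        unfolding g_def us_def using coldet_move[of "map v [0..<i]" "v i" _ "[]"] by simp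
      ultimately show ?thesis by auto
    qed
    obtain x where x: "\<And>i. i < k \<Longrightarrow> (\<Sum>r<k. g i r * x r) = q i n"
      using triangular_system[of k g "\<lambda>i. q i n"] gi g0 by blast
    define w where "w = v(n := x)"
    have "coldet (map w ([0..<i] @ [c + 1 + i - k..<c + 1])) = q i c"
      if "i < k" "k \<le> c" "c < Suc n" for i c
    proof (cases "c = n")
      case False
      then have "c < n" using that by simp
      have "map w ([0..<i] @ [c + 1 + i - k..<c + 1]) =
          map v ([0..<i] @ [c + 1 + i - k..<c + 1])"
        using \<open>c < n\<close> that by (auto simp: w_def)
      then show ?thesis by (simp only: v[OF that(1,2) \<open>c < n\<close>])
    next
      case True
      have "map w ([0..<i] @ [n + 1 + i - k..<n + 1]) = us i @ [x]"
        using that True by (auto simp: w_def us_def)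
      also have "coldet (us i @ [x]) = (\<Sum>r<k. coldet (us i @ [\<lambda>j. if j = r then 1 else 0]) * x r)"
        using coldet_expand_last[of "us i" x] len that by simp
      also have "\<dots> = (\<Sum>r<k. g i r * x r)"
        by (intro sum.cong) (auto simp: g_def unit)
      finally show ?thesis using x that True by simp
    qed
    moreover have "w j = (\<lambda>i. if i = j then 1 else 0)" if "j < k" for j
      using that True unit by (simp add: w_def)
    ultimately show ?thesis by blast
  qed
qed

section \<open>Exponential asymptotics of the minors\<close>

text \<open>This says that \<open>f x\<close> is asymptotic to \<open>c * exp (- (a * x))\<close>.
  Requiring \<open>c > 0\<close> excludes cancellation, so sums of functions correspond to minima of
  exponents and products to sums.\<close>

definition has_order :: "(real \<Rightarrow> real) \<Rightarrow> real \<Rightarrow> bool" where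
  "has_order f a \<longleftrightarrow> (\<exists>c>0. ((\<lambda>x. f x * exp (a * x)) \<longlongrightarrow> c) at_top)"

lemma has_order_exp: "has_order (\<lambda>x. exp (- (a * x))) a"
  unfolding has_order_def by (rule exI[of _ 1]) (simp flip: exp_add)

lemma has_order_mult:
  assumes "has_order f a" "has_order g b"
  shows "has_order (\<lambda>x. f x * g x) (a + b)"
proof -
  obtain c d where cd: "c > 0" "d > 0" "((\<lambda>x. f x * exp (a * x)) \<longlongrightarrow> c) at_top"
    "((\<lambda>x. g x * exp (b * x)) \<longlongrightarrow> d) at_top"
    using assms by (auto simp: has_order_def)
  have "((\<lambda>x. (f x * exp (a * x)) * (g x * exp (b * x))) \<longlongrightarrow> c * d) at_top"
    using cd by (intro tendsto_mult)
  then show ?thesis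
    unfolding has_order_def using cd
    by (intro exI[of _ "c * d"]) (simp add: algebra_simps exp_add)
qed

lemma exp_neg_tendsto_0:
  assumes "(a::real) > 0"
  shows "((\<lambda>x. exp (- (a * x))) \<longlongrightarrow> 0) at_top"
  using assms
  by (intro filterlim_compose[OF exp_at_bot] filterlim_compose[OF filterlim_uminus_at_bot_at_top]
      filterlim_tendsto_pos_mult_at_top[OF tendsto_const _ filterlim_ident])

lemma has_order_add_aux:
  assumes "has_order f a" "has_order g b" "a \<le> b"
  shows "has_order (\<lambda>x. f x + g x) a"
proof -
  obtain c d where cd: "c > 0" "d > 0" "((\<lambda>x. f x * exp (a * x)) \<longlongrightarrow> c) at_top"
    "((\<lambda>x. g x * exp (b * x)) \<longlongrightarrow> d) at_top"
    using assms by (auto simp: has_order_def)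
  \<comment> \<open>\<open>e\<close> is the limit of \<open>exp (- ((b - a) * x))\<close>: the term
    \<open>g\<close> contributes to the leading coefficient only when the exponents agree.\<close>
  define e :: real where "e = (if a = b then 1 else 0)"
  have "((\<lambda>x. exp (- ((b - a) * x))) \<longlongrightarrow> e) at_top"
    using exp_neg_tendsto_0[of "b - a"] assms by (cases "a = b") (auto simp: e_def)
  then have "((\<lambda>x. f x * exp (a * x) + (g x * exp (b * x)) * exp (- ((b - a) * x))) \<longlongrightarrow> c + d * e) at_top"
    using cd by (intro tendsto_add tendsto_mult)
  moreover have "f x * exp (a * x) + (g x * exp (b * x)) * exp (- ((b - a) * x)) =
      (f x + g x) * exp (a * x)" for x
    by (simp add: algebra_simps flip: exp_add)
  moreover have "c + d * e > 0" using cd by (simp add: e_def)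
  ultimately show ?thesis unfolding has_order_def by auto
qed

lemma has_order_add:
  assumes "has_order f a" "has_order g b"
  shows "has_order (\<lambda>x. f x + g x) (min a b)"
  using has_order_add_aux[OF assms] has_order_add_aux[OF assms(2,1)]
  by (cases "a \<le> b") (auto simp: min_def add.commute)

text \<open>The positive leading coefficient of \<open>g\<close> makes \<open>g\<close> eventually
  positive, so the quotient of the limits is legitimate.\<close>

lemma has_order_divide:
  assumes "has_order (\<lambda>x. f x * g x) (a + b)" "has_order g b"
  shows "has_order f a"
proof -
  obtain c d where cd: "c > 0" "d > 0"
    "((\<lambda>x. (f x * g x) * exp ((a + b) * x)) \<longlongrightarrow> c) at_top"
    "((\<lambda>x. g x * exp (b * x)) \<longlongrightarrow> d) at_top"
    using assms by (auto simp: has_order_def)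
  have "((\<lambda>x. ((f x * g x) * exp ((a + b) * x)) / (g x * exp (b * x))) \<longlongrightarrow> c / d) at_top"
    using cd by (intro tendsto_divide) auto
  moreover have "eventually (\<lambda>x. g x * exp (b * x) > 0) at_top"
    using cd order_tendstoD(1) by blast
  then have "eventually (\<lambda>x. ((f x * g x) * exp ((a + b) * x)) / (g x * exp (b * x)) =
      f x * exp (a * x)) at_top"
    by eventually_elim (auto simp: exp_add distrib_right)
  ultimately have "((\<lambda>x. f x * exp (a * x)) \<longlongrightarrow> c / d) at_top"
    by (simp cong: tendsto_cong)
  then show ?thesis unfolding has_order_def using cd by (intro exI[of _ "c / d"]) simp
qed

section \<open>From the prescribed minors to all minors\<close>

lemma finite_ksubsets: "finite (ksubsets n k)"
  unfolding ksubsets_def by (rule finite_subset[of _ "Pow {0..<n}"]) auto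

lemma ksubsetsD:
  assumes "I \<in> ksubsets n k"
  shows "finite I" "I \<subseteq> {0..<n}" "card I = k"
  using assms finite_subset[of I "{0..<n}"] by (auto simp: ksubsets_def)

lemma ksubsets_swap_two:
  assumes "I \<in> ksubsets n k" "b \<in> I" "d \<in> I" "b \<noteq> d" "x < n" "y < n" "x \<noteq> y"
    "x \<notin> I - {b, d}" "y \<notin> I - {b, d}"
  shows "(I - {b, d}) \<union> {x, y} \<in> ksubsets n k"
proof -
  have fin: "finite I" and card: "card I = k" using assms by (auto simp: ksubsets_def intro: finite_subset)
  have "card (I - {b, d}) = k - card {b, d}"
    using assms fin card by (subst card_Diff_subset) auto
  moreover have "card {b, d} \<le> card I" using assms fin by (intro card_mono) auto
  ultimately have "card ((I - {b, d}) \<union> {x, y}) = k"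
    using assms fin card by (subst card_Un_disjoint) auto
  then show ?thesis using assms by (auto simp: ksubsets_def)
qed

text \<open>The two alternatives together say that the crossing pair attains the minimum of the
  other two sums, the form that \<open>has_order_add\<close> produces.\<close>

lemma positive_tropical_pluecker_min:
  assumes "positive_tropical_pluecker k n P" "a < b" "b < c" "c < d" "d < n"
    "S \<subseteq> {0..<n}" "card S + 2 = k" "S \<inter> {a, b, c, d} = {}"
  shows "P (S \<union> {a, c}) + P (S \<union> {b, d}) =
    min (P (S \<union> {a, b}) + P (S \<union> {c, d})) (P (S \<union> {a, d}) + P (S \<union> {b, c}))"
proof -
  have "(P (S \<union> {a,c}) + P (S \<union> {b,d}) = P (S \<union> {a,b}) + P (S \<union> {c,d}) \<and>
         P (S \<union> {a,b}) + P (S \<union> {c,d}) \<le> P (S \<union> {a,d}) + P (S \<union> {b,c}))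
      \<or> (P (S \<union> {a,c}) + P (S \<union> {b,d}) = P (S \<union> {a,d}) + P (S \<union> {b,c}) \<and>
         P (S \<union> {a,d}) + P (S \<union> {b,c}) \<le> P (S \<union> {a,b}) + P (S \<union> {c,d}))"
    using assms unfolding positive_tropical_pluecker_def by blast
  then show ?thesis by linarith
qed

text \<open>A set \<open>I = {0..<i} \<union> J\<close> with \<open>i < Min J\<close> whose part \<open>J\<close> has a gap \<open>c\<close> is \<open>Sbd\<close> in the
  three-term relation with \<open>a = i\<close>, \<open>b = Min J\<close>, \<open>d = Max J\<close>. Each of the five other sets has a
  longer initial interval or the same one and a shorter span of \<open>J\<close>.\<close>

lemma has_order_all_minors:
  assumes P: "positive_tropical_pluecker k n P"
    and init: "has_order (\<lambda>x. minor (v x) {0..<k}) (P {0..<k})"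
    and cluster: "\<And>i s e. i < s \<Longrightarrow> s < e \<Longrightarrow> e \<le> n \<Longrightarrow> i + (e - s) = k \<Longrightarrow>
      has_order (\<lambda>x. minor (v x) ({0..<i} \<union> {s..<e})) (P ({0..<i} \<union> {s..<e}))"
    and I: "I \<in> ksubsets n k"
  shows "has_order (\<lambda>x. minor (v x) I) (P I)"
proof -
  have "has_order (\<lambda>x. minor (v x) I) (P I)"
    if "I \<in> ksubsets n k" "{0..<i} \<subseteq> I" "i \<notin> I" "I \<subseteq> {0..<i} \<union> {s..<e}" "i < s" "e \<le> n" for I i s e
    using that
  \<comment> \<open>The measure is lexicographic: \<open>e - s\<close> is less than
    \<open>n + 1\<close>, so a longer initial interval outweighs any change of the window
    \<open>{s..<e}\<close>.\<close>
  proof (induction "(n - i) * (n + 1) + (e - s)" arbitrary: I i s e rule: less_induct)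
    case less
    note I = less.prems
    have fin: "finite I" and sub: "I \<subseteq> {0..<n}" and card: "card I = k"
      using I by (auto simp: ksubsets_def intro: finite_subset)
    show ?case
    proof (cases "s < e")
      case False
      then have "I = {0..<i}" using I by auto
      then show ?thesis using card init by simp
    next
      case se: True
      \<comment> \<open>A set containing \<open>i\<close> has a later first gap \<open>j\<close>, so
        the window may be reset to \<open>{j + 1..<n}\<close>.\<close>
      have outer: "has_order (\<lambda>x. minor (v x) I') (P I')"
        if I': "I' \<in> ksubsets n k" "{0..<i} \<subseteq> I'" "i \<in> I'" for I'
      proof -
        have "n \<notin> I'" using I' by (auto simp: ksubsets_def)
        define j where "j = (LEAST x. x \<notin> I')"
        have j: "j \<notin> I'" unfolding j_def using \<open>n \<notin> I'\<close> by (rule LeastI)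
        have ltj: "x \<in> I'" if "x < j" for x using not_less_Least that unfolding j_def by blast
        have "i < j" using I' j by (metis atLeastLessThan_iff linorder_neqE_nat subsetD zero_le)
        have "i < n" using I se by simp
        have "(n - j) * (n + 1) + (n - (j + 1)) < (n - i) * (n + 1) + (e - s)"
        proof -
          have "(n - j) + 1 \<le> n - i" using \<open>i < j\<close> \<open>i < n\<close> by simp
          then have "((n - j) + 1) * (n + 1) \<le> (n - i) * (n + 1)" by (rule mult_le_mono1)
          then have "(n - j) * (n + 1) + (n + 1) \<le> (n - i) * (n + 1)"
            by (simp only: add_mult_distrib mult_1)
          then show ?thesis by linarith
        qed
        moreover have "I' \<subseteq> {0..<j} \<union> {j + 1..<n}"
        proof
          fix x assume "x \<in> I'"
          then have "x < n" "x \<noteq> j" using I' j by (auto simp: ksubsets_def)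
          then show "x \<in> {0..<j} \<union> {j + 1..<n}" by auto
        qed
        moreover have "{0..<j} \<subseteq> I'" using ltj by auto
        ultimately show ?thesis
          using less.hyps[of j n "j + 1" I'] I' j by auto
      qed
      \<comment> \<open>With the same first gap, a strictly shorter window suffices.\<close>
      have inner: "has_order (\<lambda>x. minor (v x) I') (P I')"
        if "I' \<in> ksubsets n k" "{0..<i} \<subseteq> I'" "i \<notin> I'" "I' \<subseteq> {0..<i} \<union> {s'..<e'}"
          "s \<le> s'" "e' \<le> e" "e' - s' < e - s" for I' s' e'
        using less.hyps[of i e' s' I'] that I by simp
      consider "s \<notin> I" | "e - 1 \<notin> I" | "s \<in> I" "e - 1 \<in> I" by blast
      then show ?thesis
      proof cases
        case 1
        then have "I \<subseteq> {0..<i} \<union> {Suc s..<e}"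
          using I by (auto simp: subset_iff) (metis le_eq_less_or_eq Suc_leI)
        then show ?thesis using inner[of I "Suc s" e] I se by auto
      next
        case 2
        have "I \<subseteq> {0..<i} \<union> {s..<e - 1}"
        proof
          fix x assume "x \<in> I"
          then have "x \<in> {0..<i} \<union> {s..<e}" "x \<noteq> e - 1" using I 2 by auto
          then show "x \<in> {0..<i} \<union> {s..<e - 1}" by auto
        qed
        then show ?thesis using inner[of I s "e - 1"] I se by auto
      next
        case 3
        show ?thesis
        proof (cases "{s..<e} \<subseteq> I")
          case True
          then have eq: "I = {0..<i} \<union> {s..<e}" using I by auto
          then have "card ({0..<i} \<union> {s..<e}) = k" using card by simp
          then have "i + (e - s) = k" using I by (subst (asm) card_Un_disjoint) auto
          then show ?thesis using cluster[of i s e] I se eq by simp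
        next
          case False
          then obtain c where c: "s \<le> c" "c < e" "c \<notin> I"
            by (meson atLeastLessThan_iff subsetI)
          \<comment> \<open>Both ends of the window now lie in \<open>I\<close>; \<open>i\<close>,
            \<open>s\<close>, \<open>c\<close>, \<open>d\<close> serve as the four indices of the
            three-term relation.\<close>
          define d where "d = e - 1"
          define S where "S = I - {s, d}"
          have ord: "i < s" "s < c" "c < d" "d < n"
          proof -
            show "i < s" "d < n" using I se by (auto simp: d_def)
            show "s < c" using c 3 by (cases "s = c") auto
            show "c < d" using c 3 by (cases "c = d") (auto simp: d_def)
          qed
          have mem: "s \<in> I" "d \<in> I" "i \<notin> I" "c \<notin> I" using 3 c I by (auto simp: d_def)
          have ISbd: "I = S \<union> {s, d}" using mem by (auto simp: S_def)
          have ks: "S \<union> {x, y} \<in> ksubsets n k"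
            if "x \<in> {i, s, c, d}" "y \<in> {i, s, c, d}" "x \<noteq> y" for x y
            unfolding S_def using that ord mem I(1)
            by (intro ksubsets_swap_two) auto
          have disj: "S \<inter> {i, s, c, d} = {}" using mem by (auto simp: S_def)
          have finS: "finite S" using fin by (simp add: S_def)
          have cardS: "card S + 2 = k"
            using card fin mem ord card_Diff_subset[of "{s, d}" I] card_mono[of I "{s, d}"]
            by (auto simp: S_def)
          have SI: "{0..<i} \<subseteq> S" using I ord by (auto simp: S_def)
          have o: "has_order (\<lambda>x. minor (v x) (S \<union> {i, y})) (P (S \<union> {i, y}))"
            if "y \<in> {s, c, d}" for y
            using that ord SI by (intro outer ks) auto
          have SJ: "S \<subseteq> {0..<i} \<union> {Suc s..<e - 1}"
          proof
            fix x assume "x \<in> S"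
            then have "x \<in> {0..<i} \<union> {s..<e}" "x \<noteq> e - 1" "x \<noteq> s"
              using I by (auto simp: S_def d_def)
            then show "x \<in> {0..<i} \<union> {Suc s..<e - 1}" by auto
          qed
          have ocd: "has_order (\<lambda>x. minor (v x) (S \<union> {c, d})) (P (S \<union> {c, d}))"
          proof (rule inner[of _ "Suc s" e])
            show "S \<union> {c, d} \<subseteq> {0..<i} \<union> {Suc s..<e}"
              using ord by (auto simp: d_def dest!: subsetD[OF SJ])
          qed (use ord SI mem se ks disj in \<open>auto simp: d_def\<close>)
          have obc: "has_order (\<lambda>x. minor (v x) (S \<union> {s, c})) (P (S \<union> {s, c}))"
          proof (rule inner[of _ s "e - 1"])
            show "S \<union> {s, c} \<subseteq> {0..<i} \<union> {s..<e - 1}"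
              using ord by (auto simp: d_def dest!: subsetD[OF SJ])
          qed (use ord SI mem se ks disj in \<open>auto simp: d_def\<close>)
          have "P (S \<union> {i, c}) + P (S \<union> {s, d}) =
            min (P (S \<union> {i, s}) + P (S \<union> {c, d})) (P (S \<union> {i, d}) + P (S \<union> {s, c}))"
            using ord sub disj cardS by (intro positive_tropical_pluecker_min[OF P]) (auto simp: S_def)
          moreover have "has_order (\<lambda>x. minor (v x) (S \<union> {i, s}) * minor (v x) (S \<union> {c, d}) +
              minor (v x) (S \<union> {i, d}) * minor (v x) (S \<union> {s, c}))
            (min (P (S \<union> {i, s}) + P (S \<union> {c, d})) (P (S \<union> {i, d}) + P (S \<union> {s, c})))"
            by (intro has_order_add has_order_mult o ocd obc) auto
          moreover have "minor (v x) (S \<union> {i, s}) * minor (v x) (S \<union> {c, d}) +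
              minor (v x) (S \<union> {i, d}) * minor (v x) (S \<union> {s, c}) =
              minor (v x) (S \<union> {s, d}) * minor (v x) (S \<union> {i, c})" for x
            using minor_three_term[OF finS ord(1-3) disj, of "v x"] by (simp add: mult.commute)
          \<comment> \<open>\<open>I\<close> is \<open>S \<union> {s, d}\<close>. Its order results
            from division by the minor of \<open>S \<union> {i, c}\<close>, a set that contains
            \<open>i\<close> and is covered by \<open>o\<close>.\<close>
          ultimately have "has_order (\<lambda>x. minor (v x) (S \<union> {s, d}) * minor (v x) (S \<union> {i, c}))
              (P (S \<union> {s, d}) + P (S \<union> {i, c}))"
            by (simp add: add.commute)
          then show ?thesis
            unfolding ISbd by (rule has_order_divide) (rule o, simp)
        qed
      qed
    qed
  qed
  note * = this
  \<comment> \<open>The induction starts with the first gap of \<open>I\<close> and the largest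
    window behind it.\<close>
  define i where "i = (LEAST x. x \<notin> I)"
  have "n \<notin> I" using I by (auto simp: ksubsets_def)
  then have "i \<notin> I" unfolding i_def by (rule LeastI)
  moreover have "{0..<i} \<subseteq> I" using not_less_Least unfolding i_def by fastforce
  moreover have "I \<subseteq> {0..<i} \<union> {i + 1..<n}"
  proof
    fix x assume "x \<in> I"
    then have "x < n" "x \<noteq> i" using I \<open>i \<notin> I\<close> by (auto simp: ksubsets_def)
    then show "x \<in> {0..<i} \<union> {i + 1..<n}" by auto
  qed
  ultimately show ?thesis using *[of I i "i + 1" n] I by auto
qed

section \<open>Minimizers of a positive tropical Pluecker vector\<close>

text \<open>A nonzero minor of size \<open>k\<close> bounds the rank from below, the dimension of
  the column space's ambient space from above.\<close>

lemma rank_eq_of_pluecker_nonzero: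
  assumes A: "A \<in> carrier_mat k n" and I: "I \<in> ksubsets n k" and "pluecker k A I \<noteq> 0"
  shows "vec_space.rank k A = k"
proof (rule antisym)
  have "{j. j < n \<and> j \<in> I} = I" "card I = k" using I by (auto simp: ksubsets_def)
  then show "k \<le> vec_space.rank k A"
    using vec_space.rank_gt_minor[OF A, of "{0..<k}" I] assms(3) by (simp add: pluecker_def)
  interpret vec_space "TYPE(real)" k .
  have cols: "set (cols A) \<subseteq> carrier_vec k" using A cols_dim by blast
  have "subspace class_ring (span (set (cols A))) V" using cols by (intro span_is_subspace) auto
  then show "vec_space.rank k A \<le> k"
    unfolding rank_def using subspace_dim[of "span (set (cols A))"] fin_dim fin_dim_span_cols[OF A] dim_is_n
    by simp
qed

text \<open>A matrix is chosen for each \<open>x\<close> separately. Its first \<open>k\<close>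
  columns form the identity, so the minor of \<open>{0..<k}\<close> is constantly \<open>1\<close>,
  which matches \<open>P {0..<k} = 0\<close>.\<close>

lemma exists_matrix_family:
  assumes P: "positive_tropical_pluecker k n P" and P0: "P {0..<k} = 0"
  shows "\<exists>v. \<forall>I \<in> ksubsets n k. has_order (\<lambda>x. minor (v x) I) (P I)"
proof -
  define q where "q x i c = exp (- (P ({0..<i} \<union> {c + 1 + i - k..<c + 1}) * x))" for x i c
  have "\<exists>v. (\<forall>j<k. v j = (\<lambda>i. if i = j then 1 else 0)) \<and>
      (\<forall>i c. i < k \<and> k \<le> c \<and> c < n \<longrightarrow>
        coldet (map v ([0..<i] @ [c + 1 + i - k..<c + 1])) = q x i c)" for x
    by (rule prescribed_minors) (simp add: q_def)
  then obtain v where unit: "\<And>x j. j < k \<Longrightarrow> v x j = (\<lambda>i. if i = j then 1 else 0)"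
    and v: "\<And>x i c. i < k \<Longrightarrow> k \<le> c \<Longrightarrow> c < n \<Longrightarrow>
      coldet (map (v x) ([0..<i] @ [c + 1 + i - k..<c + 1])) = q x i c"
    by metis
  have "minor (v x) {0..<k} = 1" for x
  proof -
    have "map (v x) [0..<k] = map (\<lambda>j i. if i = j then 1 else 0) [0..<k]" using unit by simp
    then show ?thesis by (simp only: minor_def sorted_list_of_set_range coldet_unit_columns)
  qed
  then have init: "has_order (\<lambda>x. minor (v x) {0..<k}) (P {0..<k})"
    using has_order_exp[of 0] P0 by simp
  have "has_order (\<lambda>x. minor (v x) ({0..<i} \<union> {s..<e})) (P ({0..<i} \<union> {s..<e}))"
    if ise: "i < s" "s < e" "e \<le> n" "i + (e - s) = k" for i s e
  proof -
    have "sorted_list_of_set ({0..<i} \<union> {s..<e}) = [0..<i] @ [s..<e]"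
      by (rule sorted_distinct_set_unique) (use ise in \<open>auto simp: sorted_append\<close>)
    \<comment> \<open>With \<open>e - 1\<close> as last column, the interval in \<open>q\<close>
      becomes \<open>{s..<e}\<close>.\<close>
    moreover have se: "e - 1 + 1 = e" "e + i - k = s" using ise by auto
    moreover have "i < k" "k \<le> e - 1" "e - 1 < n" using ise by auto
    ultimately have "minor (v x) ({0..<i} \<union> {s..<e}) = q x i (e - 1)" for x
      using v[of i "e - 1" x] by (simp only: minor_def se)
    moreover have "q x i (e - 1) = exp (- (P ({0..<i} \<union> {s..<e}) * x))" for x
      by (simp only: q_def se)
    ultimately show ?thesis using has_order_exp by (simp only:)
  qed
  then show ?thesis
    using has_order_all_minors[OF P, of v] init by blast
qed

text \<open>The entries of \<open>v x\<close> need not converge, but quotients of minors by a minor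
  of minimal order do. The limit is therefore taken in coordinates with respect to the columns of a
  minimizer \<open>J0\<close>.\<close>

theorem argmin_is_positroid_normalized:
  assumes P: "positive_tropical_pluecker k n P" and P0: "P {0..<k} = 0" and kn: "k \<le> n"
  shows "is_positroid k n {I \<in> ksubsets n k. \<forall>J \<in> ksubsets n k. P I \<le> P J}"
proof -
  let ?K = "ksubsets n k"
  let ?M = "{I \<in> ?K. \<forall>J \<in> ?K. P I \<le> P J}"
  obtain v where v: "\<And>I. I \<in> ?K \<Longrightarrow> has_order (\<lambda>x. minor (v x) I) (P I)"
    using exists_matrix_family[OF P P0] by blast
  have "{0..<k} \<in> ?K" using kn by (auto simp: ksubsets_def)
  then obtain J0 where J0: "J0 \<in> ?K" "\<And>J. J \<in> ?K \<Longrightarrow> P J0 \<le> P J"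
    using ex_is_arg_min_if_finite[OF finite_ksubsets, of n k P]
    by (auto simp: is_arg_min_linorder)
  have M: "I \<in> ?M \<longleftrightarrow> P I = P J0" if "I \<in> ?K" for I
  proof
    assume "I \<in> ?M"
    then show "P I = P J0" using J0(1) J0(2)[OF that] by (intro antisym) auto
  qed (use J0 that in auto)
  have nz: "eventually (\<lambda>x. minor (v x) J0 \<noteq> 0) at_top"
  proof -
    obtain c where "c > 0" "((\<lambda>x. minor (v x) J0 * exp (P J0 * x)) \<longlongrightarrow> c) at_top"
      using v[OF J0(1)] by (auto simp: has_order_def)
    then have "eventually (\<lambda>x. minor (v x) J0 * exp (P J0 * x) > 0) at_top"
      using order_tendstoD(1) by blast
    then show ?thesis by eventually_elim auto
  qed
  \<comment> \<open>The quotient behaves like a positive multiple of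
    \<open>exp (- ((P I - P J0) * x))\<close>. The exponent difference is nonnegative and vanishes
    exactly for minimizers.\<close>
  have ex_\<rho>: "\<exists>\<rho>. ((\<lambda>x. minor (v x) I / minor (v x) J0) \<longlongrightarrow> \<rho>) at_top \<and> \<rho> \<ge> 0 \<and> (\<rho> \<noteq> 0 \<longleftrightarrow> I \<in> ?M)"
    if I: "I \<in> ?K" for I
  proof -
    obtain c d where cd: "c > 0" "d > 0" "((\<lambda>x. minor (v x) I * exp (P I * x)) \<longlongrightarrow> c) at_top"
      "((\<lambda>x. minor (v x) J0 * exp (P J0 * x)) \<longlongrightarrow> d) at_top"
      using v[OF I] v[OF J0(1)] by (auto simp: has_order_def)
    define e :: real where "e = (if P I = P J0 then 1 else 0)"
    have "((\<lambda>x. exp (- ((P I - P J0) * x))) \<longlongrightarrow> e) at_top"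
      using exp_neg_tendsto_0[of "P I - P J0"] J0(2)[OF I]
      by (cases "P I = P J0") (auto simp: e_def)
    then have "((\<lambda>x. (minor (v x) I * exp (P I * x)) / (minor (v x) J0 * exp (P J0 * x)) *
        exp (- ((P I - P J0) * x))) \<longlongrightarrow> c / d * e) at_top"
      using cd by (intro tendsto_mult tendsto_divide) auto
    moreover have "(minor (v x) I * exp (P I * x)) / (minor (v x) J0 * exp (P J0 * x)) *
        exp (- ((P I - P J0) * x)) = minor (v x) I / minor (v x) J0" for x
    proof -
      define F E where "F = exp (P J0 * x)" and "E = exp ((P I - P J0) * x)"
      have e1: "exp (P I * x) = F * E"
        by (simp add: F_def E_def algebra_simps flip: exp_add)
      have e2: "exp (- ((P I - P J0) * x)) = inverse E" by (simp only: E_def exp_minus)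
      have "F \<noteq> 0" "E \<noteq> 0" by (simp_all add: F_def E_def)
      then show ?thesis unfolding e1 e2 F_def[symmetric] by simp
    qed
    ultimately show ?thesis
      using cd M[OF I] by (intro exI[of _ "c / d * e"]) (auto simp: e_def)
  qed
  define \<rho> where "\<rho> I = (SOME \<rho>. ((\<lambda>x. minor (v x) I / minor (v x) J0) \<longlongrightarrow> \<rho>) at_top \<and>
    \<rho> \<ge> 0 \<and> (\<rho> \<noteq> 0 \<longleftrightarrow> I \<in> ?M))" for I
  have \<rho>: "((\<lambda>x. minor (v x) I / minor (v x) J0) \<longlongrightarrow> \<rho> I) at_top" "\<rho> I \<ge> 0"
    "\<rho> I \<noteq> 0 \<longleftrightarrow> I \<in> ?M" if "I \<in> ?K" for I
    using someI_ex[OF ex_\<rho>[OF that]] unfolding \<rho>_def[symmetric] by blast+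
  define js where "js = sorted_list_of_set J0"
  have js: "length js = k" "set js = J0" "distinct js"
    using ksubsetsD[OF J0(1)] by (simp_all add: js_def)
  \<comment> \<open>By Cramer's rule these are the coordinates of column \<open>j\<close> in the
    basis formed by the columns of \<open>J0\<close>.\<close>
  define u where "u x j r = coldet (map (v x) (js[r := j])) / minor (v x) J0" for x j r
  \<comment> \<open>Each coordinate is, up to a constant factor, a quotient of two minors, or it is
    \<open>0\<close> because a column repeats.\<close>
  have ex_b: "\<exists>b. ((\<lambda>x. u x j r) \<longlongrightarrow> b) at_top" if jr: "j < n" "r < k" for j r
  proof (cases "distinct (js[r := j])")
    case True
    have "set (js[r := j]) \<subseteq> insert j J0" using js set_update_subset_insert by metis
    then have mem: "set (js[r := j]) \<in> ?K"
      using True js J0(1) jr distinct_card[OF True] by (auto simp: ksubsets_def)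
    obtain s where "\<And>v. coldet (map v (js[r := j])) = s * minor v (set (js[r := j]))"
      using coldet_eq_minor[OF True] by blast
    then have "(\<lambda>x. u x j r) = (\<lambda>x. s * (minor (v x) (set (js[r := j])) / minor (v x) J0))"
      by (simp add: u_def)
    then show ?thesis using tendsto_mult[OF tendsto_const \<rho>(1)[OF mem]] by auto
  next
    case False
    then have "\<not> distinct (map (v x) (js[r := j]))" for x by (auto simp: distinct_map)
    then have "(\<lambda>x. u x j r) = (\<lambda>x. 0)"
      by (simp add: u_def coldet_not_distinct)
    then show ?thesis by auto
  qed
  define w where "w j r = (SOME b. ((\<lambda>x. u x j r) \<longlongrightarrow> b) at_top)" for j r
  have w: "((\<lambda>x. u x j r) \<longlongrightarrow> w j r) at_top" if "j < n" "r < k" for j r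
    unfolding w_def by (rule someI_ex[OF ex_b[OF that]])
  have minor_w: "minor w I = \<rho> I" if I: "I \<in> ?K" for I
  proof -
    let ?xs = "sorted_list_of_set I"
    have xs: "length ?xs = k" "set ?xs = I" "I \<subseteq> {0..<n}"
      using ksubsetsD[OF I] by simp_all
    have "((\<lambda>x. minor (u x) I) \<longlongrightarrow> minor w I) at_top"
      unfolding minor_def
    proof (rule tendsto_coldet)
      fix i j assume "i < length ?xs" "j < length ?xs"
      moreover from this have "?xs ! j < n" using xs nth_mem by fastforce
      ultimately show "((\<lambda>x. u x (?xs ! j) i) \<longlongrightarrow> w (?xs ! j) i) at_top"
        using w xs by simp
    qed
    \<comment> \<open>The columns of \<open>J0\<close> form a basis only for large \<open>x\<close>,
      hence an eventual equality.\<close>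
    moreover have "eventually (\<lambda>x. minor (u x) I = minor (v x) I / minor (v x) J0) at_top"
      using nz
    proof eventually_elim
      case (elim x)
      then have js0: "coldet (map (v x) js) \<noteq> 0" by (simp add: minor_def js_def)
      have m: "map (\<lambda>y r. coldet ((map (v x) js)[r := y]) / coldet (map (v x) js)) (map (v x) ?xs) =
          map (u x) ?xs"
        by (simp add: u_def map_update minor_def js_def fun_eq_iff)
      have "length (map (v x) ?xs) = length (map (v x) js)" using xs js by simp
      from coldet_change_basis[OF js0 this]
      have "minor (v x) I = minor (v x) J0 * minor (u x) I"
        unfolding m by (simp only: minor_def js_def)
      then show ?case using elim by simp
    qed
    ultimately have "((\<lambda>x. minor (v x) I / minor (v x) J0) \<longlongrightarrow> minor w I) at_top"
      by (rule Lim_transform_eventually)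
    then show ?thesis using \<rho>(1)[OF I] tendsto_unique[OF trivial_limit_at_top_linorder] by blast
  qed
  define A where "A = mat k n (\<lambda>(i, j). w j i)"
  have A: "A \<in> carrier_mat k n" by (simp add: A_def)
  have pA: "pluecker k A I = \<rho> I" if I: "I \<in> ?K" for I
  proof -
    let ?xs = "sorted_list_of_set I"
    have xs: "length ?xs = k" "set ?xs = I" "I \<subseteq> {0..<n}"
      using ksubsetsD[OF I] by simp_all
    have lt: "?xs ! j < n" if "j < k" for j using xs that nth_mem by fastforce
    have "mat k k (\<lambda>(i, j). (map (\<lambda>j i. A $$ (i, j)) ?xs ! j) i) =
        mat k k (\<lambda>(i, j). (map w ?xs ! j) i)"
      using xs lt by (intro eq_matI) (auto simp: A_def)
    then have "minor (\<lambda>j i. A $$ (i, j)) I = minor w I"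
      using xs by (simp add: minor_def coldet_def)
    then show ?thesis using pluecker_eq_minor[OF A I] minor_w[OF I] by simp
  qed
  have "vec_space.rank k A = k"
    using rank_eq_of_pluecker_nonzero[OF A J0(1)] pA[OF J0(1)] \<rho>(3)[OF J0(1)] M[OF J0(1)] by simp
  moreover have "?M = {I \<in> ?K. pluecker k A I \<noteq> 0}"
  proof (rule Collect_cong, rule conj_cong)
    fix I assume "I \<in> ?K"
    then show "(\<forall>J \<in> ?K. P I \<le> P J) \<longleftrightarrow> pluecker k A I \<noteq> 0"
      using pA[of I] \<rho>(3)[of I] by simp
  qed simp
  ultimately show ?thesis
    unfolding is_positroid_def using A pA \<rho>(2) by (intro exI[of _ A]) auto
qed

text \<open>All three sums of the relation grow by the same amount: twice \<open>sum w S\<close>,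
  the four weights, and twice the constant.\<close>

lemma positive_tropical_pluecker_add_modular:
  assumes "positive_tropical_pluecker k n P"
  shows "positive_tropical_pluecker k n (\<lambda>I. P I + (\<Sum>i\<in>I. w i) + c)"
  unfolding positive_tropical_pluecker_def
proof (intro allI impI, elim conjE)
  fix a b c' d S
  assume *: "a < b" "b < c'" "c' < d" "d < n" "S \<subseteq> {0..<n}" "card S + 2 = k" "S \<inter> {a, b, c', d} = {}"
  have fin: "finite S" using * by (auto intro: finite_subset)
  have w: "sum w (S \<union> {x, y}) = sum w S + w x + w y"
    if "x \<in> {a, b, c', d}" "y \<in> {a, b, c', d}" "x \<noteq> y" for x y
    using that * fin by (subst sum.union_disjoint) auto
  have P: "P (S \<union> {a, c'}) + P (S \<union> {b, d}) =
    min (P (S \<union> {a, b}) + P (S \<union> {c', d})) (P (S \<union> {a, d}) + P (S \<union> {b, c'}))"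
    using * by (intro positive_tropical_pluecker_min[OF assms])
  have "sum w (S \<union> {a, b}) = sum w S + w a + w b" "sum w (S \<union> {a, c'}) = sum w S + w a + w c'"
    "sum w (S \<union> {a, d}) = sum w S + w a + w d" "sum w (S \<union> {b, c'}) = sum w S + w b + w c'"
    "sum w (S \<union> {b, d}) = sum w S + w b + w d" "sum w (S \<union> {c', d}) = sum w S + w c' + w d"
    using * by (intro w; simp)+
  note weq = this
  let ?Q = "\<lambda>I. P I + sum w I + c"
  show "(?Q (S \<union> {a, c'}) + ?Q (S \<union> {b, d}) = ?Q (S \<union> {a, b}) + ?Q (S \<union> {c', d}) \<and>
      ?Q (S \<union> {a, b}) + ?Q (S \<union> {c', d}) \<le> ?Q (S \<union> {a, d}) + ?Q (S \<union> {b, c'})) \<or>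
    (?Q (S \<union> {a, c'}) + ?Q (S \<union> {b, d}) = ?Q (S \<union> {a, d}) + ?Q (S \<union> {b, c'}) \<and>
      ?Q (S \<union> {a, d}) + ?Q (S \<union> {b, c'}) \<le> ?Q (S \<union> {a, b}) + ?Q (S \<union> {c', d}))"
  proof (cases "P (S \<union> {a, b}) + P (S \<union> {c', d}) \<le> P (S \<union> {a, d}) + P (S \<union> {b, c'})")
    case True
    moreover have "P (S \<union> {a, c'}) + P (S \<union> {b, d}) = P (S \<union> {a, b}) + P (S \<union> {c', d})"
      using P unfolding min_def if_P[OF True] .
    ultimately show ?thesis unfolding weq by (intro disjI1 conjI) linarith+
  next
    case False
    moreover have "P (S \<union> {a, c'}) + P (S \<union> {b, d}) = P (S \<union> {a, d}) + P (S \<union> {b, c'})"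
      using P unfolding min_def if_not_P[OF False] .
    ultimately show ?thesis unfolding weq by (intro disjI2 conjI) linarith+
  qed
qed

definition argmin_sets :: "nat \<Rightarrow> nat \<Rightarrow> (nat set \<Rightarrow> real) \<Rightarrow> nat set set" where
  "argmin_sets k n P = {I \<in> ksubsets n k. \<forall>J \<in> ksubsets n k. P I \<le> P J}"

theorem argmin_is_positroid:
  assumes "positive_tropical_pluecker k n P" "k \<le> n"
  shows "is_positroid k n (argmin_sets k n (\<lambda>I. P I + (\<Sum>i\<in>I. w i)))"
proof -
  \<comment> \<open>The added constant normalizes \<open>Q {0..<k}\<close> to \<open>0\<close> and
    does not affect the minimizers.\<close>
  define Q where "Q I = P I + (\<Sum>i\<in>I. w i) + - (P {0..<k} + (\<Sum>i = 0..<k. w i))" for I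
  have "positive_tropical_pluecker k n Q"
    unfolding Q_def by (rule positive_tropical_pluecker_add_modular[OF assms(1)])
  moreover have "Q {0..<k} = 0" by (simp add: Q_def)
  ultimately have "is_positroid k n {I \<in> ksubsets n k. \<forall>J \<in> ksubsets n k. Q I \<le> Q J}"
    using assms(2) by (rule argmin_is_positroid_normalized)
  then show ?thesis by (simp add: Q_def argmin_sets_def)
qed

section \<open>Faces of the regular subdivision\<close>

text \<open>In a convex combination attaining the bound \<open>m\<close>, the deficits
  \<open>u v * (m - f v)\<close> are nonnegative with sum \<open>0\<close>, so generators below
  \<open>m\<close> have weight \<open>0\<close>.\<close>

lemma convex_hull_linear_maximum:
  fixes f :: "'a::real_vector \<Rightarrow> real"
  assumes "finite V" "linear f" "\<And>v. v \<in> V \<Longrightarrow> f v \<le> m"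
  shows "{x \<in> convex hull V. f x = m} = convex hull {v \<in> V. f v = m}"
proof (intro equalityI subsetI)
  fix x assume "x \<in> {x \<in> convex hull V. f x = m}"
  then obtain u where u: "\<And>v. v \<in> V \<Longrightarrow> 0 \<le> u v" "sum u V = 1" "(\<Sum>v\<in>V. u v *\<^sub>R v) = x"
    and fx: "f x = m"
    using convex_hull_finite[OF assms(1)] by auto
  have "f x = (\<Sum>v\<in>V. u v * f v)"
    using u(3) linear_sum[OF assms(2), of "\<lambda>v. u v *\<^sub>R v" V] linear_scale[OF assms(2)] by auto
  moreover have "m = (\<Sum>v\<in>V. u v * m)" using u(2) by (simp flip: sum_distrib_right)
  ultimately have "(\<Sum>v\<in>V. u v * (m - f v)) = 0"
    using fx by (simp add: right_diff_distrib sum_subtractf)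
  then have "\<forall>v\<in>V. u v * (m - f v) = 0"
    using assms u(1) by (subst (asm) sum_nonneg_eq_0_iff) auto
  then have u0: "u v = 0" if "v \<in> V" "f v \<noteq> m" for v using that by auto
  let ?W = "{v \<in> V. f v = m}"
  have "sum u ?W = 1" using u(2) u0 assms(1) sum.mono_neutral_left[of V ?W u] by auto
  moreover have "(\<Sum>v\<in>?W. u v *\<^sub>R v) = x"
    using u(3) u0 assms(1) sum.mono_neutral_left[of V ?W "\<lambda>v. u v *\<^sub>R v"] by auto
  ultimately show "x \<in> convex hull ?W"
    using assms(1) u(1) by (subst convex_hull_finite) auto
next
  fix x assume x: "x \<in> convex hull {v \<in> V. f v = m}"
  have "convex {x. f x = m}"
    unfolding convex_def
    by (auto simp: linear_add[OF assms(2)] linear_scale[OF assms(2)] simp flip: distrib_right)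
  then have "convex hull {v \<in> V. f v = m} \<subseteq> {x. f x = m}" by (intro hull_minimal) auto
  moreover have "convex hull {v \<in> V. f v = m} \<subseteq> convex hull V" by (intro hull_mono) auto
  ultimately show "x \<in> {x \<in> convex hull V. f x = m}" using x by auto
qed

lemma convex_hull_le_linear:
  fixes f :: "'a::real_vector \<Rightarrow> real"
  assumes "linear f" "\<And>v. v \<in> V \<Longrightarrow> f v \<le> m" "x \<in> convex hull V"
  shows "f x \<le> m"
proof -
  have "convex {x. f x \<le> m}"
    unfolding convex_def
  proof (clarsimp simp: linear_add[OF assms(1)] linear_scale[OF assms(1)])
    fix x y u v assume "f x \<le> m" "f y \<le> m" "0 \<le> u" "0 \<le> v" "u + v = (1::real)"
    then show "u * f x + v * f y \<le> m" by (rule convex_bound_le)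
  qed
  then have "convex hull V \<subseteq> {x. f x \<le> m}" using assms(2) by (intro hull_minimal) auto
  then show ?thesis using assms(3) by auto
qed

lemma linear_pairing: "linear (pairing n a b)"
  by (rule linearI)
    (auto simp: pairing_def scaleR_fun_def algebra_simps sum.distrib sum_distrib_left)

lemma linear_fst_prod: "linear fst"
  by (rule linearI) auto

lemma pairing_eI:
  assumes "I \<subseteq> {0..<n}"
  shows "pairing n a b (eI I, t) = (\<Sum>i\<in>I. a i) + b * t"
proof -
  have "(\<Sum>i<n. a i * eI I i) = (\<Sum>i\<in>I. a i)"
    using assms by (intro sum.mono_neutral_cong_right) (auto simp: eI_def)
  then show ?thesis by (simp add: pairing_def)
qed

text \<open>On a lifted vertex the functional equals
  \<open>b * (P I + (\<Sum>i\<in>I. a i / b))\<close>; since \<open>b < 0\<close>, maximizing it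
  means minimizing the bracket.\<close>

lemma lower_face_projection:
  assumes b: "b < 0" and ne: "ksubsets n k \<noteq> {}"
  shows "fst ` {x \<in> lifted_polytope k n P. \<forall>y \<in> lifted_polytope k n P. pairing n a b y \<le> pairing n a b x} =
    convex hull (eI ` argmin_sets k n (\<lambda>I. P I + (\<Sum>i\<in>I. a i / b)))"
proof -
  let ?K = "ksubsets n k"
  let ?V = "(\<lambda>I. (eI I, P I)) ` ?K"
  let ?Q = "lifted_polytope k n P"
  let ?f = "pairing n a b"
  define m where "m = Max (?f ` ?V)"
  have fin: "finite ?V" using finite_ksubsets by blast
  have le: "?f v \<le> m" if "v \<in> ?V" for v unfolding m_def using fin that by (intro Max_ge) auto
  have "m \<in> ?f ` ?V" unfolding m_def using fin ne by (intro Max_in) auto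
  then obtain v0 where v0: "v0 \<in> ?V" "?f v0 = m" by auto
  have Qle: "?f x \<le> m" if "x \<in> ?Q" for x
    
  proof -
    have "x \<in> convex hull ?V" using that by (simp add: lifted_polytope_def)
    then show ?thesis by (rule convex_hull_le_linear[OF linear_pairing le, rotated])
  qed
  have "v0 \<in> ?Q" using v0 hull_subset[of ?V convex] by (auto simp: lifted_polytope_def)
  then have "{x \<in> ?Q. \<forall>y \<in> ?Q. ?f y \<le> ?f x} = {x \<in> ?Q. ?f x = m}"
    using Qle v0 by (auto intro: antisym)
  also have "\<dots> = convex hull {v \<in> ?V. ?f v = m}"
    unfolding lifted_polytope_def by (rule convex_hull_linear_maximum[OF fin linear_pairing le])
  finally have "fst ` {x \<in> ?Q. \<forall>y \<in> ?Q. ?f y \<le> ?f x} = convex hull (fst ` {v \<in> ?V. ?f v = m})"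
    by (simp only: convex_hull_linear_image[OF linear_fst_prod])
  also have "fst ` {v \<in> ?V. ?f v = m} = eI ` argmin_sets k n (\<lambda>I. P I + (\<Sum>i\<in>I. a i / b))"
  proof -
    have val: "?f (eI I, P I) = b * (P I + (\<Sum>i\<in>I. a i / b))" if "I \<in> ?K" for I
      using that b pairing_eI[of I n a b "P I"]
      by (simp add: ksubsets_def distrib_left sum_distrib_left)
    have "?f (eI I, P I) = m \<longleftrightarrow> (\<forall>J \<in> ?K. P I + (\<Sum>i\<in>I. a i / b) \<le> P J + (\<Sum>i\<in>J. a i / b))"
      if I: "I \<in> ?K" for I
    proof -
      have "?f (eI I, P I) = m \<longleftrightarrow> (\<forall>J \<in> ?K. ?f (eI J, P J) \<le> ?f (eI I, P I))"
      proof
        assume "?f (eI I, P I) = m"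
        then show "\<forall>J \<in> ?K. ?f (eI J, P J) \<le> ?f (eI I, P I)" using le by auto
      next
        assume *: "\<forall>J \<in> ?K. ?f (eI J, P J) \<le> ?f (eI I, P I)"
        have "m \<le> ?f (eI I, P I)" using v0 * by auto
        moreover have "?f (eI I, P I) \<le> m" using I by (intro le) auto
        ultimately show "?f (eI I, P I) = m" by simp
      qed
      also have "\<dots> \<longleftrightarrow> (\<forall>J \<in> ?K. P I + (\<Sum>i\<in>I. a i / b) \<le> P J + (\<Sum>i\<in>J. a i / b))"
        using b I by (intro ball_cong refl) (simp only: val mult_le_cancel_left, simp)
      finally show ?thesis .
    qed
    then have "{v \<in> ?V. ?f v = m} = (\<lambda>I. (eI I, P I)) ` argmin_sets k n (\<lambda>I. P I + (\<Sum>i\<in>I. a i / b))"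
      by (auto simp: argmin_sets_def)
    then show ?thesis by (simp add: image_image)
  qed
  finally show ?thesis .
qed

lemma argmin_sets_nonempty:
  assumes "ksubsets n k \<noteq> {}"
  shows "argmin_sets k n P \<noteq> {}"
  using ex_is_arg_min_if_finite[OF finite_ksubsets assms, of P]
  by (auto simp: argmin_sets_def is_arg_min_linorder)

text \<open>A normal \<open>(a, b)\<close> gives the weight \<open>a / b\<close>; conversely a
  weight \<open>w\<close> comes from the normal \<open>(- w, - 1)\<close>.\<close>

lemma subdivision_faces_eq:
  assumes ne: "ksubsets n k \<noteq> {}"
  shows "subdivision_faces k n P =
    range (\<lambda>w. convex hull (eI ` argmin_sets k n (\<lambda>I. P I + (\<Sum>i\<in>I. w i))))"
proof (intro equalityI subsetI)
  fix \<Gamma> assume "\<Gamma> \<in> subdivision_faces k n P"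
  then obtain a b where "b < 0"
    "\<Gamma> = fst ` {x \<in> lifted_polytope k n P. \<forall>y \<in> lifted_polytope k n P. pairing n a b y \<le> pairing n a b x}"
    by (auto simp: subdivision_faces_def lower_face_def)
  then show "\<Gamma> \<in> range (\<lambda>w. convex hull (eI ` argmin_sets k n (\<lambda>I. P I + (\<Sum>i\<in>I. w i))))"
    using lower_face_projection[OF _ ne] by blast
next
  fix \<Gamma> assume "\<Gamma> \<in> range (\<lambda>w. convex hull (eI ` argmin_sets k n (\<lambda>I. P I + (\<Sum>i\<in>I. w i))))"
  then obtain w where w: "\<Gamma> = convex hull (eI ` argmin_sets k n (\<lambda>I. P I + (\<Sum>i\<in>I. w i)))" by blast
  let ?F = "{x \<in> lifted_polytope k n P. \<forall>y \<in> lifted_polytope k n P.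
    pairing n (\<lambda>i. - w i) (- 1) y \<le> pairing n (\<lambda>i. - w i) (- 1) x}"
  have \<Gamma>: "\<Gamma> = fst ` ?F"
    using lower_face_projection[of "- 1" n k P "\<lambda>i. - w i"] ne w by simp
  have "\<Gamma> \<noteq> {}" using w argmin_sets_nonempty[OF ne] by simp
  then have "?F \<noteq> {}" using \<Gamma> by blast
  moreover have "\<exists>a b. b < 0 \<and> ?F = {x \<in> lifted_polytope k n P. \<forall>y \<in> lifted_polytope k n P.
      pairing n a b y \<le> pairing n a b x}"
    by (intro exI[of _ "\<lambda>i. - w i"] exI[of _ "- 1 :: real"] conjI refl) simp
  ultimately have "lower_face n (lifted_polytope k n P) ?F"
    unfolding lower_face_def by (rule conjI)
  then show "\<Gamma> \<in> subdivision_faces k n P"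
    unfolding subdivision_faces_def using \<Gamma> by blast
qed

section \<open>Vertices of the faces\<close>

lemma inj_eI: "inj eI"
proof (rule injI)
  fix I J assume "eI I = eI J"
  then have eq: "eI I x = eI J x" for x by simp
  have "x \<in> I \<longleftrightarrow> x \<in> J" for x
    using eq[of x] by (simp add: eI_def split: if_splits)
  then show "I = J" by blast
qed

text \<open>The hull lies in the unit cube, and every coordinate of \<open>eI I\<close> is an
  endpoint of the unit interval. A segment with \<open>eI I\<close> in its interior is thus constant
  in each coordinate.\<close>

lemma extreme_points_eI:
  "{v. v extreme_point_of (convex hull (eI ` M))} = eI ` M"
proof
  show "{v. v extreme_point_of (convex hull (eI ` M))} \<subseteq> eI ` M"
    by (rule extreme_points_of_convex_hull)
  have cube: "x \<in> convex hull (eI ` M) \<Longrightarrow> 0 \<le> x i \<and> x i \<le> 1" for x i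
  proof -
    have "convex {x :: nat \<Rightarrow> real. \<forall>i. 0 \<le> x i \<and> x i \<le> 1}"
      unfolding convex_def by (auto simp: scaleR_fun_def intro!: convex_bound_le)
    then have "convex hull (eI ` M) \<subseteq> {x. \<forall>i. 0 \<le> x i \<and> x i \<le> 1}"
      by (intro hull_minimal) (auto simp: eI_def)
    then show "x \<in> convex hull (eI ` M) \<Longrightarrow> 0 \<le> x i \<and> x i \<le> 1" by auto
  qed
  show "eI ` M \<subseteq> {v. v extreme_point_of (convex hull (eI ` M))}"
  proof clarify
    fix I assume I: "I \<in> M"
    have False if x: "x \<in> convex hull (eI ` M)" and y: "y \<in> convex hull (eI ` M)"
      and seg: "eI I \<in> open_segment x y" for x y
    proof -
      obtain u where u: "x \<noteq> y" "0 < u" "u < 1" "eI I = (1 - u) *\<^sub>R x + u *\<^sub>R y"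
        using seg by (auto simp: in_segment)
      have "x i = y i" for i
      proof -
        have eq: "eI I i = (1 - u) * x i + u * y i"
          using fun_cong[OF u(4), of i] by (simp add: scaleR_fun_def)
        have xi: "0 \<le> x i" "x i \<le> 1" "0 \<le> y i" "y i \<le> 1" using cube x y by auto
        show ?thesis
        proof (cases "i \<in> I")
          case True
          then have "(1 - u) * (1 - x i) + u * (1 - y i) = 0"
            using eq by (simp add: eI_def algebra_simps)
          moreover have "0 \<le> (1 - u) * (1 - x i)" "0 \<le> u * (1 - y i)" using u xi by auto
          ultimately have "(1 - u) * (1 - x i) = 0" "u * (1 - y i) = 0" by linarith+
          then show ?thesis using u by auto
        next
          case False
          then have "(1 - u) * x i + u * y i = 0" using eq by (simp add: eI_def)
          moreover have "0 \<le> (1 - u) * x i" "0 \<le> u * y i" using u xi by auto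
          ultimately have "(1 - u) * x i = 0" "u * y i = 0" by linarith+
          then show ?thesis using u by auto
        qed
      qed
      then show False using u(1) by auto
    qed
    then show "eI I extreme_point_of (convex hull (eI ` M))"
      using I by (auto simp: extreme_point_of_def intro: hull_inc)
  qed
qed

text \<open>Since the vertices of the hull recover \<open>M\<close>, the geometric condition becomes
  a purely combinatorial one.\<close>

lemma positroidal_convex_hull_eI:
  assumes "M \<subseteq> ksubsets n k"
  shows "positroidal k n (convex hull (eI ` M)) \<longleftrightarrow> is_positroid k n M"
proof -
  have "{I \<in> ksubsets n k. eI I extreme_point_of (convex hull (eI ` M))} = M"
    using extreme_points_eI[of M] assms inj_eI by (auto simp: set_eq_iff inj_image_mem_iff)
  then show ?thesis using assms extreme_points_eI[of M] by (auto simp: positroidal_def)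
qed

section \<open>Recovering the tropical relation from the faces\<close>

lemma subsets_of_octahedron:
  assumes "I \<in> ksubsets n k" "S \<subseteq> I" "I \<subseteq> S \<union> {a, b, c, d}" "card S + 2 = k" "S \<inter> {a, b, c, d} = {}"
  shows "I \<in> {S \<union> {a, b}, S \<union> {a, c}, S \<union> {a, d}, S \<union> {b, c}, S \<union> {b, d}, S \<union> {c, d}}"
proof -
  have fin: "finite I" "card I = k" using assms by (auto simp: ksubsets_def intro: finite_subset)
  then have "card (I - S) = 2" using assms(2,4) finite_subset[OF assms(2)] by (simp add: card_Diff_subset)
  then obtain x y where xy: "I - S = {x, y}" "x \<noteq> y" by (auto simp: card_2_iff)
  then have I: "I = S \<union> {x, y}" and "x \<in> {a, b, c, d}" "y \<in> {a, b, c, d}" using assms(2,3) by auto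
  then have "{x, y} \<in> {{a, b}, {a, c}, {a, d}, {b, c}, {b, d}, {c, d}}"
    using xy(2) by (auto simp: doubleton_eq_iff)
  then have "S \<union> {x, y} \<in> (\<union>) S ` {{a, b}, {a, c}, {a, d}, {b, c}, {b, d}, {c, d}}"
    by (rule imageI)
  then show ?thesis by (simp only: I image_insert image_empty)
qed

text \<open>The weights \<open>- l i / 4\<close> are chosen to equalize the values on opposite vertices of the
  octahedron \<open>{Sab, \<dots>, Scd}\<close>; the large weight \<open>T\<close> excludes all other sets from the minimizers.\<close>

lemma positive_tropical_pluecker_if_argmin_positroids:
  assumes pos: "\<And>w. ksubsets n k \<noteq> {} \<Longrightarrow> is_positroid k n (argmin_sets k n (\<lambda>I. P I + (\<Sum>i\<in>I. w i)))"
  shows "positive_tropical_pluecker k n P"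
  unfolding positive_tropical_pluecker_def
proof (intro allI impI, elim conjE)
  fix a b c d S
  assume ord: "a < b" "b < c" "c < d" "d < n" and S: "S \<subseteq> {0..<n}" "card S + 2 = k"
    and disj: "S \<inter> {a, b, c, d} = {}"
  let ?K = "ksubsets n k"
  have fin: "finite S" using S by (auto intro: finite_subset)
  define X where "X = P (S \<union> {a, c}) + P (S \<union> {b, d})"
  define Y where "Y = P (S \<union> {a, b}) + P (S \<union> {c, d})"
  define Z where "Z = P (S \<union> {a, d}) + P (S \<union> {b, c})"
  define x where "x = P (S \<union> {a, c}) - P (S \<union> {b, d})"
  define y where "y = P (S \<union> {a, b}) - P (S \<union> {c, d})"
  define z where "z = P (S \<union> {a, d}) - P (S \<union> {b, c})"
  \<comment> \<open>\<open>l\<close> solves \<open>l a + l c = 2 * x\<close>,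
    \<open>l a + l b = 2 * y\<close>, \<open>l a + l d = 2 * z\<close>, and the complementary pairs
    have the negative sums. The weights \<open>- l i / 4\<close> thus move both values of an
    opposite pair to their mean.\<close>
  define l where "l = (\<lambda>i. if i = a then x + y + z else if i = b then y - x - z
    else if i = c then x - y - z else z - x - y)"
  obtain N where N: "\<And>I. I \<in> ?K \<Longrightarrow> \<bar>P I\<bar> \<le> N"
    using finite_ksubsets[of n k] by (metis (no_types, lifting) Max_ge finite_imageI imageI)
  define L where "L = \<bar>l a\<bar> + \<bar>l b\<bar> + \<bar>l c\<bar> + \<bar>l d\<bar>"
  have "L \<ge> 0" by (simp add: L_def)
  \<comment> \<open>\<open>P\<close> varies by at most \<open>2 * \<bar>N\<bar>\<close>, and the
    weights on \<open>a\<close>, \<open>b\<close>, \<open>c\<close>, \<open>d\<close> account for at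
    most \<open>2 * L\<close>; the summand \<open>1\<close> makes the inequality \<open>far\<close>
    strict.\<close>
  define T where "T = 2 * \<bar>N\<bar> + 2 * L + 1"
  have T0: "T > 0" using \<open>L \<ge> 0\<close> by (simp add: T_def)
  define w where "w i = (if i \<in> {a, b, c, d} then - l i / 4 else if i \<in> S then - T else T)" for i
  define f where "f I = P I + (\<Sum>i\<in>I. w i)" for I
  have Sks: "S \<union> {p, q} \<in> ?K" if "p \<in> {a, b, c, d}" "q \<in> {a, b, c, d}" "p \<noteq> q" for p q
    using that ord S disj fin by (auto simp: ksubsets_def card_insert_if)
  have wS: "sum w S = - T * card S"
  proof -
    have "sum w S = (\<Sum>i\<in>S. - T)" using disj by (intro sum.cong) (auto simp: w_def)
    then show ?thesis by simp
  qed
  have fS: "f (S \<union> {p, q}) = P (S \<union> {p, q}) - T * card S - (l p + l q) / 4"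
    if "p \<in> {a, b, c, d}" "q \<in> {a, b, c, d}" "p \<noteq> q" for p q
  proof -
    have "sum w (S \<union> {p, q}) = sum w S + sum w {p, q}"
      using that disj fin by (intro sum.union_disjoint) auto
    moreover have "w p = - l p / 4" "w q = - l q / 4" using that by (auto simp: w_def)
    ultimately show ?thesis using that(3) wS by (simp add: f_def add_divide_distrib)
  qed
  have l: "l a = x + y + z" "l b = y - x - z" "l c = x - y - z" "l d = z - x - y"
    using ord by (auto simp: l_def)
  define t where "t = T * card S"
  have f6: "f (S \<union> {a, c}) = X / 2 - t" "f (S \<union> {b, d}) = X / 2 - t"
    "f (S \<union> {a, b}) = Y / 2 - t" "f (S \<union> {c, d}) = Y / 2 - t"
    "f (S \<union> {a, d}) = Z / 2 - t" "f (S \<union> {b, c}) = Z / 2 - t"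
    using ord by (subst fS; simp add: l X_def Y_def Z_def x_def y_def z_def t_def field_simps)+
  have far: "f (S \<union> {p, q}) < f I"
    if I: "I \<in> ?K" "\<not> (S \<subseteq> I \<and> I \<subseteq> S \<union> {a, b, c, d})"
      and pq: "p \<in> {a, b, c, d}" "q \<in> {a, b, c, d}" "p \<noteq> q" for I p q
  proof -
    let ?U = "S \<union> {a, b, c, d}"
    have finI: "finite I" using I by (auto simp: ksubsets_def intro: finite_subset)
    have "I = (I \<inter> {a, b, c, d}) \<union> ((I \<inter> S) \<union> (I - ?U))" by auto
    then have "sum w I = sum w ((I \<inter> {a, b, c, d}) \<union> ((I \<inter> S) \<union> (I - ?U)))" by simp
    also have "\<dots> = sum w (I \<inter> {a, b, c, d}) + (sum w (I \<inter> S) + sum w (I - ?U))"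
      using finI disj by (subst sum.union_disjoint; (subst sum.union_disjoint)?) auto
    also have "sum w (I \<inter> S) = - T * card (I \<inter> S)"
    proof -
      have "sum w (I \<inter> S) = (\<Sum>i\<in>I \<inter> S. - T)" using disj by (intro sum.cong) (auto simp: w_def)
      then show ?thesis by simp
    qed
    also have "sum w (I - ?U) = T * card (I - ?U)"
    proof -
      have "sum w (I - ?U) = (\<Sum>i\<in>I - ?U. T)" by (intro sum.cong) (auto simp: w_def)
      then show ?thesis by simp
    qed
    finally have "sum w I = sum w (I \<inter> {a, b, c, d}) + (- T * card (I \<inter> S) + T * card (I - ?U))" .
    moreover have "- L \<le> sum w (I \<inter> {a, b, c, d})"
    proof -
      have "\<bar>sum w (I \<inter> {a, b, c, d})\<bar> \<le> (\<Sum>i\<in>I \<inter> {a, b, c, d}. \<bar>w i\<bar>)" by (rule sum_abs)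
      also have "\<dots> \<le> (\<Sum>i\<in>{a, b, c, d}. \<bar>w i\<bar>)" by (intro sum_mono2) auto
      also have "\<dots> \<le> L" using ord by (simp add: w_def L_def)
      finally show ?thesis by simp
    qed
    \<comment> \<open>Missing an element of \<open>S\<close> or having one outside \<open>?U\<close>
      costs at least one \<open>T\<close>.\<close>
    moreover have mono: "T * (real (card S) - 1) \<ge> T * (real (card (I \<inter> S)) - real (card (I - ?U)))"
    proof (rule mult_left_mono)
      have "card (I \<inter> S) \<le> card S" using fin by (intro card_mono) auto
      moreover have "card (I \<inter> S) < card S" if "\<not> S \<subseteq> I"
        using that fin by (intro psubset_card_mono) auto
      moreover have "card (I - ?U) > 0" if "\<not> I \<subseteq> ?U"
        using that finI by (auto simp: card_gt_0_iff)
      ultimately show "real (card (I \<inter> S)) - real (card (I - ?U)) \<le> real (card S) - 1"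
        using I(2) by (cases "S \<subseteq> I") auto
    qed (use T0 in simp)
    moreover have "- \<bar>N\<bar> \<le> P I" "P (S \<union> {p, q}) \<le> \<bar>N\<bar>"
      using N[OF I(1)] N[OF Sks[OF pq]] by auto
    moreover have "- ((l p + l q) / 4) \<le> L"
    proof -
      have "- l i \<le> L" if "i \<in> {a, b, c, d}" for i
      proof -
        have "\<bar>l i\<bar> \<le> L" using that by (auto simp: L_def)
        then show ?thesis by (rule abs_le_D2)
      qed
      from this[OF pq(1)] this[OF pq(2)] show ?thesis using \<open>L \<ge> 0\<close> by (simp add: field_simps)
    qed
    moreover have "T * real (card S) - T \<ge> T * real (card (I \<inter> S)) - T * real (card (I - ?U))"
      using mono by (simp only: right_diff_distrib mult_1_right)
    moreover have "f I = P I + sum w I" by (simp only: f_def)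
    moreover note fS[OF pq] \<open>L \<ge> 0\<close> T_def
    ultimately show ?thesis by linarith
  qed
  let ?M = "argmin_sets k n (\<lambda>I. P I + (\<Sum>i\<in>I. w i))"
  \<comment> \<open>By \<open>far\<close> only the vertices of the octahedron compete, and by
    \<open>f6\<close> their values are those of the three pairs.\<close>
  have M: "S \<union> {p, q} \<in> ?M \<longleftrightarrow> f (S \<union> {p, q}) \<le> X / 2 - t \<and> f (S \<union> {p, q}) \<le> Y / 2 - t \<and>
      f (S \<union> {p, q}) \<le> Z / 2 - t"
    if pq: "p \<in> {a, b, c, d}" "q \<in> {a, b, c, d}" "p \<noteq> q" for p q
  proof -
    have "S \<union> {p, q} \<in> ?M \<longleftrightarrow> (\<forall>J \<in> ?K. f (S \<union> {p, q}) \<le> f J)"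
      using Sks[OF pq] by (simp add: argmin_sets_def f_def)
    also have "\<dots> \<longleftrightarrow> f (S \<union> {p, q}) \<le> X / 2 - t \<and> f (S \<union> {p, q}) \<le> Y / 2 - t \<and>
      f (S \<union> {p, q}) \<le> Z / 2 - t" (is "?l \<longleftrightarrow> ?r")
    proof
      assume l: ?l
      have "S \<union> {a, c} \<in> ?K" "S \<union> {a, b} \<in> ?K" "S \<union> {a, d} \<in> ?K"
        using ord by (intro Sks; simp)+
      from this[THEN bspec[OF l]] have "f (S \<union> {p, q}) \<le> f (S \<union> {a, c})"
        "f (S \<union> {p, q}) \<le> f (S \<union> {a, b})" "f (S \<union> {p, q}) \<le> f (S \<union> {a, d})" .
      then show ?r unfolding f6 by (intro conjI)
    next
      assume r: ?r
      show ?l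
      proof
        fix J assume J: "J \<in> ?K"
        show "f (S \<union> {p, q}) \<le> f J"
        proof (cases "S \<subseteq> J \<and> J \<subseteq> S \<union> {a, b, c, d}")
          case True
          have "J \<in> {S \<union> {a, b}, S \<union> {a, c}, S \<union> {a, d}, S \<union> {b, c}, S \<union> {b, d}, S \<union> {c, d}}"
            by (intro subsets_of_octahedron[OF J _ _ S(2) disj] conjunct1[OF True] conjunct2[OF True])
          then have "f J \<in> {X / 2 - t, Y / 2 - t, Z / 2 - t}"
            by (elim insertE emptyE; simp only: f6 insert_iff simp_thms)
          then show ?thesis using r by auto
        next
          case False
          then show ?thesis using far[OF J False pq] by simp
        qed
      qed
    qed
    finally show ?thesis .
  qed
  obtain A :: "real mat" where A: "A \<in> carrier_mat k n"
    and nonneg: "\<And>I. I \<in> ?K \<Longrightarrow> pluecker k A I \<ge> 0"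
    and supp: "?M = {I \<in> ?K. pluecker k A I \<noteq> 0}"
    using pos[of w] Sks[of a b] ord unfolding is_positroid_def by blast
  define p where "p s t = pluecker k A (S \<union> {s, t})" for s t
  have p: "p s t \<ge> 0" "p s t \<noteq> 0 \<longleftrightarrow> S \<union> {s, t} \<in> ?M" "p s t = minor (\<lambda>j i. A $$ (i, j)) (S \<union> {s, t})"
    if "s \<in> {a, b, c, d}" "t \<in> {a, b, c, d}" "s \<noteq> t" for s t
  proof -
    show "p s t \<ge> 0" unfolding p_def by (intro nonneg Sks that)
    show "p s t \<noteq> 0 \<longleftrightarrow> S \<union> {s, t} \<in> ?M"
      unfolding p_def supp using Sks[OF that] by simp
    show "p s t = minor (\<lambda>j i. A $$ (i, j)) (S \<union> {s, t})"
      unfolding p_def by (rule pluecker_eq_minor[OF A Sks[OF that]])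
  qed
  have ne: "a \<noteq> b" "a \<noteq> c" "a \<noteq> d" "b \<noteq> c" "b \<noteq> d" "c \<noteq> d" using ord by auto
  have rel: "p a c * p b d = p a b * p c d + p a d * p b c"
    using minor_three_term[OF fin ord(1-3) disj] ne by (simp add: p(3) del: Un_insert_right)
  have nz: "p a c \<noteq> 0 \<longleftrightarrow> X \<le> Y \<and> X \<le> Z" "p b d \<noteq> 0 \<longleftrightarrow> X \<le> Y \<and> X \<le> Z"
    "p a b \<noteq> 0 \<longleftrightarrow> Y \<le> X \<and> Y \<le> Z" "p c d \<noteq> 0 \<longleftrightarrow> Y \<le> X \<and> Y \<le> Z"
    "p a d \<noteq> 0 \<longleftrightarrow> Z \<le> X \<and> Z \<le> Y" "p b c \<noteq> 0 \<longleftrightarrow> Z \<le> X \<and> Z \<le> Y"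
    using ne by (simp_all add: p(2) M f6 del: Un_insert_right)
  have ge: "0 \<le> p a b * p c d" "0 \<le> p a d * p b c"
    using ne by (simp_all add: p(1))
  \<comment> \<open>If \<open>X\<close> is minimal, the left product in \<open>rel\<close> is
    nonzero, so a right summand is nonzero and its pair is minimal too. Otherwise the left product
    is \<open>0\<close>, both nonnegative summands vanish, and no pair would be minimal.\<close>
  have "(X = Y \<and> Y \<le> Z) \<or> (X = Z \<and> Z \<le> Y)"
  proof (cases "X \<le> Y \<and> X \<le> Z")
    case True
    then have "p a c * p b d \<noteq> 0" using nz by simp
    then have "p a b * p c d \<noteq> 0 \<or> p a d * p b c \<noteq> 0" using rel by auto
    then have "Y \<le> X \<and> Y \<le> Z \<or> Z \<le> X \<and> Z \<le> Y" using nz by auto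
    then show ?thesis using True by linarith
  next
    case False
    then have "p a c * p b d = 0" using nz by auto
    then have "p a b * p c d = 0" "p a d * p b c = 0" using rel ge by linarith+
    then have "\<not> (Y \<le> X \<and> Y \<le> Z)" "\<not> (Z \<le> X \<and> Z \<le> Y)" using nz by auto
    then show ?thesis using False by linarith
  qed
  then show "(P (S \<union> {a, c}) + P (S \<union> {b, d}) = P (S \<union> {a, b}) + P (S \<union> {c, d}) \<and>
      P (S \<union> {a, b}) + P (S \<union> {c, d}) \<le> P (S \<union> {a, d}) + P (S \<union> {b, c})) \<or>
    (P (S \<union> {a, c}) + P (S \<union> {b, d}) = P (S \<union> {a, d}) + P (S \<union> {b, c}) \<and>
      P (S \<union> {a, d}) + P (S \<union> {b, c}) \<le> P (S \<union> {a, b}) + P (S \<union> {c, d}))"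
    unfolding X_def Y_def Z_def .
qed

theorem theorem9p9:
  fixes k n :: nat and P :: "nat set \<Rightarrow> real"
  shows "positive_tropical_pluecker k n P \<longleftrightarrow>
         (\<forall>\<Gamma> \<in> subdivision_faces k n P. positroidal k n \<Gamma>)"
proof (cases "ksubsets n k = {}")
  case True
  \<comment> \<open>For \<open>k > n\<close> the lifted polytope is empty and faces are nonempty by
    definition, so both sides hold trivially.\<close>
  then have "subdivision_faces k n P = {}"
    by (simp add: subdivision_faces_def lower_face_def lifted_polytope_def)
  moreover have "positive_tropical_pluecker k n P"
    by (rule positive_tropical_pluecker_if_argmin_positroids) (use True in simp)
  ultimately show ?thesis by simp
next
  case False
  then have "k \<le> n" by (auto simp: ksubsets_def dest!: card_mono[rotated])
  have faces: "(\<forall>\<Gamma> \<in> subdivision_faces k n P. positroidal k n \<Gamma>) \<longleftrightarrow>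
      (\<forall>w. is_positroid k n (argmin_sets k n (\<lambda>I. P I + (\<Sum>i\<in>I. w i))))"
    unfolding subdivision_faces_eq[OF False]
    by (subst ball_simps, subst positroidal_convex_hull_eI) (auto simp: argmin_sets_def)
  show ?thesis
    unfolding faces
    using argmin_is_positroid[OF _ \<open>k \<le> n\<close>] positive_tropical_pluecker_if_argmin_positroids by blast
qed

end
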